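(* Let $G$ be a finitely generated weakly branched self-similar group, and assume that it admits a finitely generated branching subgroup $K$. Then $K$ and hence $G$ are uniformly SENS.
   Context: Let $X$ be a finite set and $W$ the automorphism group of the regular rooted tree $X^*$ (edges between $v$ and $vx$), acting on the right. For $g\in W$ let $\pi\in\mathrm{Sym}(X)$ be the restriction of $g$ to $X$, and for $x\in X$ let $g@x\in W$ be defined by $(xv)^g=x^{\pi}v^{g@x}$. The map $\phi:W\to W^X\rtimes\mathrm{Sym}(X)$, $g\mapsto(x\mapsto g@x)\,\pi$, is an isomorphism. A subgroup $G\le W$ is self-similar if $g@x\in G$ for all $g\in G$, $x\in X$. A self-similar group $G$ is weakly branched if there is a non-trivial subgroup $K\le G$ with $\phi(K)\ge K^X$, i.e. for all $k\in K$, $x\in X$ the automorphism acting as $k$ on $xX^*$ (that is $xv\mapsto xv^k$) and trivially elsewhere lies in $K$; such a $K$ is called a branching subgroup. No transitivity on levels is required. A finite standard generating set of a finitely generated group $G$ is $\Sigma=S\cup S^{-1}\cup\{1\}$, where $S$ is a finite set together with a surjective homomorphism from the free group on $S$ onto $G$; words over $\Sigma$ are evaluated in $G$, the letter $1$ evaluating to the identity. For words, $(a_1\cdots a_n)^{-1}=a_n^{-1}\cdots a_1^{-1}$ and $[h,g]=h^{-1}g^{-1}hg$. $G$ is strongly efficiently non-solvable (SENS) if there is a constant $\mu\in\mathbb{N}$ such that for every $d\in\mathbb{N}$ there are words $g_{d,v}\in\Sigma^*$ for $v\in\{0,1\}^{\le d}$ with (a) $|g_{d,v}|=2^{\mu d}$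 for $v\in\{0,1\}^d$; (b) $g_{d,v}=[g_{d,v0},g_{d,v1}]$ (as words) for $v\in\{0,1\}^{<d}$; (c) $g_{d,\varepsilon}\neq1$ in $G$. It is uniformly SENS if moreover (d) given $v\in\{0,1\}^d$, a number $i$ in binary with $\mu d$ bits, and $a\in\Sigma$, one can decide in $\mathsf{DLINTIME}$ (deterministic linear time, on Turing machines with random access to the input) whether the $i$-th letter of $g_{d,v}$ is $a$. These properties do not depend on the choice of $\Sigma$. *)

theory Defs
  imports "HOL-Algebra.Generated_Groups"
begin

section \<open>Automorphisms of the regular rooted tree\<close>

text \<open>
  The vertices of the tree are the words over the alphabet, which is a type of class
  \<^class>\<open>finite\<close>; the root is the empty word.
\<close>

definition tree_adj :: "'x list \<Rightarrow> 'x list \<Rightarrow> bool" where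
  "tree_adj v w \<longleftrightarrow> (\<exists>x. w = v @ [x] \<or> v = w @ [x])"

definition tree_aut :: "('x list \<Rightarrow> 'x list) \<Rightarrow> bool" where
  "tree_aut g \<longleftrightarrow> bij g \<and> g [] = [] \<and> (\<forall>v w. tree_adj (g v) (g w) \<longleftrightarrow> tree_adj v w)"

text \<open>
  Automorphisms act on the right: the image of \<open>v\<close> under \<open>g \<otimes> h\<close> is \<open>h (g v)\<close>.
\<close>

definition tree_aut_group :: "('x list \<Rightarrow> 'x list) monoid" where
  "tree_aut_group = \<lparr>carrier = {g. tree_aut g}, monoid.mult = (\<lambda>g h. h \<circ> g), one = id\<rparr>"

text \<open>
  The state \<open>g@x\<close>: for a tree automorphism, \<open>g (x # v) = hd (g [x]) # state_at g x v\<close>.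
\<close>

definition state_at :: "('x list \<Rightarrow> 'x list) \<Rightarrow> 'x \<Rightarrow> 'x list \<Rightarrow> 'x list" where
  "state_at g x = (\<lambda>v. tl (g (x # v)))"

definition self_similar :: "('x list \<Rightarrow> 'x list) set \<Rightarrow> bool" where
  "self_similar G \<longleftrightarrow>
     subgroup G tree_aut_group \<and> (\<forall>g\<in>G. \<forall>x. state_at g x \<in> G)"

text \<open>The map acting as \<open>k\<close> below the first-level vertex \<open>x\<close> and trivially elsewhere.\<close>

fun place_at :: "'x \<Rightarrow> ('x list \<Rightarrow> 'x list) \<Rightarrow> 'x list \<Rightarrow> 'x list" where
  "place_at x k [] = []"
| "place_at x k (y # v) = (if y = x then x # k v else y # v)"

definition branching_subgroup ::
  "('x list \<Rightarrow> 'x list) set \<Rightarrow> ('x list \<Rightarrow> 'x list) set \<Rightarrow> bool" where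
  "branching_subgroup K G \<longleftrightarrow>
     subgroup K (tree_aut_group\<lparr>carrier := G\<rparr>) \<and> K \<noteq> {\<one>\<^bsub>tree_aut_group\<^esub>} \<and>
     (\<forall>k\<in>K. \<forall>x. place_at x k \<in> K)"

definition weakly_branched :: "('x list \<Rightarrow> 'x list) set \<Rightarrow> bool" where
  "weakly_branched G \<longleftrightarrow> self_similar G \<and> (\<exists>K. branching_subgroup K G)"


section \<open>Words over standard generating sets\<close>

definition finitely_generated :: "('a, 'b) monoid_scheme \<Rightarrow> bool" where
  "finitely_generated G \<longleftrightarrow>
     (\<exists>S. finite S \<and> S \<subseteq> carrier G \<and> generate G S = carrier G)"

text \<open>
  A homomorphism from the free group on \<open>S\<close> to \<open>G\<close> is given by its values \<open>\<nu>\<close> on \<open>S\<close>, and its image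
  is the subgroup generated by \<open>\<nu> ` S\<close>. The map \<open>\<nu>\<close> need not be injective. Indexing the generators
  by natural numbers is no restriction, as \<open>S\<close> is finite.
\<close>

definition standard_gens :: "('a, 'b) monoid_scheme \<Rightarrow> nat set \<Rightarrow> (nat \<Rightarrow> 'a) \<Rightarrow> bool" where
  "standard_gens G S \<nu> \<longleftrightarrow>
     finite S \<and> \<nu> ` S \<subseteq> carrier G \<and> generate G (\<nu> ` S) = carrier G"

datatype letter = Gen nat | Inv nat | Unit

definition letters :: "nat set \<Rightarrow> letter set" where
  "letters S = Gen ` S \<union> Inv ` S \<union> {Unit}"

fun inv_letter :: "letter \<Rightarrow> letter" where
  "inv_letter (Gen s) = Inv s"
| "inv_letter (Inv s) = Gen s"
| "inv_letter Unit = Unit"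

definition inv_word :: "letter list \<Rightarrow> letter list" where
  "inv_word w = rev (map inv_letter w)"

definition commutator_word :: "letter list \<Rightarrow> letter list \<Rightarrow> letter list" where
  "commutator_word h g = inv_word h @ inv_word g @ h @ g"

fun letter_value :: "('a, 'b) monoid_scheme \<Rightarrow> (nat \<Rightarrow> 'a) \<Rightarrow> letter \<Rightarrow> 'a" where
  "letter_value G \<nu> (Gen s) = \<nu> s"
| "letter_value G \<nu> (Inv s) = inv\<^bsub>G\<^esub> (\<nu> s)"
| "letter_value G \<nu> Unit = \<one>\<^bsub>G\<^esub>"

definition word_value :: "('a, 'b) monoid_scheme \<Rightarrow> (nat \<Rightarrow> 'a) \<Rightarrow> letter list \<Rightarrow> 'a" where
  "word_value G \<nu> w = foldr (\<lambda>a r. letter_value G \<nu> a \<otimes>\<^bsub>G\<^esub> r) w \<one>\<^bsub>G\<^esub>"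


section \<open>Linear time on random-access Turing machines\<close>

text \<open>
  Deterministic multi-tape Turing machines. The tapes are infinite to the right and initially
  blank (symbol \<open>0\<close>); moving left on cell \<open>0\<close> has no effect. The read-only input is not on a tape:
  tape \<open>0\<close> is the index tape, and in every step the machine sees the input symbol whose position
  is written there in binary, or \<^const>\<open>None\<close> if the input is not that long. The least significant
  digit is in cell \<open>0\<close>; symbol \<open>1\<close> is the digit one and every other symbol, including the blank,
  is the digit zero. The machine halts when the transition function returns \<^const>\<open>None\<close>.
\<close>

datatype move = MoveL | Stay | MoveR

record 'i rtm =
  num_states :: nat
  num_symbols :: nat
  num_tapes :: nat
  trans :: "nat \<Rightarrow> 'i option \<Rightarrow> nat list \<Rightarrow> (nat \<times> (nat \<times> move) list) option"
  accepting :: "nat set"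

definition rtm_wf :: "'i set \<Rightarrow> 'i rtm \<Rightarrow> bool" where
  "rtm_wf \<Gamma> M \<longleftrightarrow>
     num_states M \<ge> 1 \<and> num_symbols M \<ge> 2 \<and> num_tapes M \<ge> 1 \<and>
     (\<forall>q < num_states M. \<forall>a \<in> insert None (Some ` \<Gamma>). \<forall>rs \<in> lists {..<num_symbols M}.
        length rs = num_tapes M \<longrightarrow>
        (case trans M q a rs of
           None \<Rightarrow> True
         | Some (q', acts) \<Rightarrow> q' < num_states M \<and> length acts = num_tapes M \<and>
             (\<forall>(s, m) \<in> set acts. s < num_symbols M)))"

text \<open>A tape is its head position together with its contents; state \<open>0\<close> is initial.\<close>

type_synonym tape = "nat \<times> (nat \<Rightarrow> nat)"
type_synonym config = "nat \<times> tape list"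

definition rtm_init :: "'i rtm \<Rightarrow> config" where
  "rtm_init M = (0, replicate (num_tapes M) (0, \<lambda>_. 0))"

definition tape_read :: "tape \<Rightarrow> nat" where
  "tape_read T = snd T (fst T)"

fun tape_act :: "tape \<Rightarrow> nat \<times> move \<Rightarrow> tape" where
  "tape_act (p, f) (s, m) =
     ((case m of MoveL \<Rightarrow> p - 1 | Stay \<Rightarrow> p | MoveR \<Rightarrow> p + 1), f(p := s))"

definition index_value :: "tape \<Rightarrow> nat" where
  "index_value T = (\<Sum>j | snd T j = 1. 2 ^ j)"

definition input_at :: "'i list \<Rightarrow> nat \<Rightarrow> 'i option" where
  "input_at w p = (if p < length w then Some (w ! p) else None)"

definition rtm_next :: "'i rtm \<Rightarrow> 'i list \<Rightarrow> config \<Rightarrow> (nat \<times> (nat \<times> move) list) option" where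
  "rtm_next M w c =
     trans M (fst c) (input_at w (index_value (hd (snd c)))) (map tape_read (snd c))"

definition rtm_step :: "'i rtm \<Rightarrow> 'i list \<Rightarrow> config \<Rightarrow> config" where
  "rtm_step M w c =
     (case rtm_next M w c of
        None \<Rightarrow> c
      | Some (q', acts) \<Rightarrow> (q', map2 tape_act (snd c) acts))"

definition rtm_run :: "'i rtm \<Rightarrow> 'i list \<Rightarrow> nat \<Rightarrow> config" where
  "rtm_run M w t = (rtm_step M w ^^ t) (rtm_init M)"

definition DLINTIME :: "'i set \<Rightarrow> 'i list set set" where
  "DLINTIME \<Gamma> = {L. finite \<Gamma> \<and> L \<subseteq> lists \<Gamma> \<and>
     (\<exists>M C. rtm_wf \<Gamma> M \<and>
        (\<forall>w \<in> lists \<Gamma>. \<exists>t \<le> C * (length w + 1).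
           rtm_next M w (rtm_run M w t) = None \<and>
           (fst (rtm_run M w t) \<in> accepting M \<longleftrightarrow> w \<in> L)))}"


section \<open>Efficient non-solvability\<close>

text \<open>The bit \<open>0\<close> is \<^const>\<open>False\<close>, and \<open>g d v\<close> is the word attached to \<open>v\<close> for depth \<open>d\<close>.\<close>

definition SENS_words ::
  "('a, 'b) monoid_scheme \<Rightarrow> nat set \<Rightarrow> (nat \<Rightarrow> 'a) \<Rightarrow> nat \<Rightarrow>
   (nat \<Rightarrow> bool list \<Rightarrow> letter list) \<Rightarrow> bool" where
  "SENS_words G S \<nu> \<mu> g \<longleftrightarrow> (\<forall>d.
     (\<forall>v. length v \<le> d \<longrightarrow> g d v \<in> lists (letters S)) \<and>
     (\<forall>v. length v = d \<longrightarrow> length (g d v) = 2 ^ (\<mu> * d)) \<and>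
     (\<forall>v. length v < d \<longrightarrow> g d v = commutator_word (g d (v @ [False])) (g d (v @ [True]))) \<and>
     word_value G \<nu> (g d []) \<noteq> \<one>\<^bsub>G\<^esub>)"

datatype insym = Bit bool | Sep | Letter letter

definition insyms :: "nat set \<Rightarrow> insym set" where
  "insyms S = range Bit \<union> {Sep} \<union> Letter ` letters S"

text \<open>
  The position \<open>i\<close> is written with its most significant bit first, and positions in a word are
  counted from \<open>0\<close>, so that the numbers with \<open>\<mu> * d\<close> bits are exactly the positions in \<open>g d v\<close>.
\<close>

definition letter_language ::
  "nat set \<Rightarrow> nat \<Rightarrow> (nat \<Rightarrow> bool list \<Rightarrow> letter list) \<Rightarrow> insym list set" where
  "letter_language S \<mu> g =
     {map Bit v @ [Sep] @ map Bit i @ [Sep] @ [Letter a] | d v i a.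
        length v = d \<and> length i = \<mu> * d \<and> a \<in> letters S \<and>
        g d v ! horner_sum of_bool 2 (rev i) = a}"

text \<open>
  The property does not depend on the standard generating set; it is required for all of them,
  and finite generation ensures that there is one.
\<close>

definition uniformly_SENS :: "('a, 'b) monoid_scheme \<Rightarrow> bool" where
  "uniformly_SENS G \<longleftrightarrow>
     finitely_generated G \<and>
     (\<forall>S \<nu>. standard_gens G S \<nu> \<longrightarrow>
        (\<exists>\<mu> g. SENS_words G S \<nu> \<mu> g \<and> letter_language S \<mu> g \<in> DLINTIME (insyms S)))"

end

theory Submission
  imports Defs
begin

text \<open>
  Write \<open>v*g\<close> for the automorphism acting as \<open>g\<close> below the vertex \<open>v\<close> and trivially elsewhere. If
  \<open>v\<close>, \<open>v\<^sup>k\<close> and \<open>v\<^sup>l\<close> are distinct vertices, then \<open>[v*g\<^sup>-\<^sup>1, k]\<close> acts as \<open>g\<close> below \<open>v\<close>, in some way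
  below \<open>v\<^sup>k\<close>, and trivially elsewhere. Hence
  \<open>v*[g, h] = [[v*g\<^sup>-\<^sup>1, k], [v*h\<^sup>-\<^sup>1, l]]\<close>. If \<open>k \<in> K\<close> moves a vertex \<open>u\<close>, one may take \<open>v = uu\<close> and
  \<open>l = u*k\<close>, and \<open>[k, l] \<noteq> 1\<close>. Starting from \<open>(g, h) = (k, l)\<close> and passing to \<open>(v*g\<^sup>-\<^sup>1, k)\<close> at a bit
  \<open>0\<close> and to \<open>(v*h\<^sup>-\<^sup>1, l)\<close> at a bit \<open>1\<close>, one obtains a commutator tree of depth \<open>d\<close> whose root is
  \<open>[k, l]\<close>, placed \<open>d - 1\<close> times at \<open>v\<close>, and whose leaves are \<open>k\<^sup>\<plusminus>\<^sup>1\<close> or \<open>l\<^sup>\<plusminus>\<^sup>1\<close>, placed at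
  \<open>v\<close> fewer than \<open>d\<close> times.

  As \<open>K\<close> is finitely generated, placing at \<open>v\<close> is a substitution that replaces every letter by
  \<open>2\<^sup>q\<close> letters. Thus a letter of a leaf is found by a finite automaton that reads the position in
  blocks of \<open>q\<close> bits and the path backwards, one bit per block. A one-way machine with one work
  tape does this in real time; the index tape of the random-access machine is then only used as a
  counter, whose increments take constant amortized time.
\<close>

section \<open>One-way machines with one work tape\<close>

text \<open>One input symbol is consumed per step, so a run is a left fold over the input and no
  input position has to be stored.\<close>

fun online_step ::
  "('q \<Rightarrow> 'i \<Rightarrow> nat \<Rightarrow> 'q \<times> nat \<times> move) \<Rightarrow> 'q \<times> tape \<Rightarrow> 'i \<Rightarrow> 'q \<times> tape" where
  "online_step \<delta> (q, T) a =
     (case \<delta> q a (tape_read T) of (q', act) \<Rightarrow> (q', tape_act T act))"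

lemma tape_act_stay [simp]: "tape_act T (tape_read T, Stay) = T"
  by (cases T) (simp add: tape_read_def)

lemma mod3_simps [simp]:
  fixes e :: nat
  shows "Suc (3 * e) mod 3 = 1" "Suc (Suc (3 * e)) mod 3 = 2"
    "\<not> 3 dvd Suc (3 * e)" "\<not> 3 dvd Suc (Suc (3 * e))"
  by presburger+

text \<open>The counter needs the symbols 0, 1 and 2 and shares its alphabet with the work tape,
  hence \<open>3 \<le> m\<close>. The code 0 of \<open>q0\<close> matches the initial state of an
  \<open>rtm\<close>.\<close>

locale online_machine =
  fixes \<Gamma> :: "'i set" and Q :: "'q set" and m :: nat
    and \<delta> :: "'q \<Rightarrow> 'i \<Rightarrow> nat \<Rightarrow> 'q \<times> nat \<times> move"
    and q0 :: 'q and F :: "'q set"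
    and enc :: "'q \<Rightarrow> nat"
  assumes q0: "q0 \<in> Q" and m: "3 \<le> m"
    and closed: "\<And>q a r q' s mv. q \<in> Q \<Longrightarrow> a \<in> \<Gamma> \<Longrightarrow> r < m \<Longrightarrow>
      \<delta> q a r = (q', s, mv) \<Longrightarrow> q' \<in> Q \<and> s < m"
    and enc: "bij_betw enc Q {..<card Q}" and enc_q0: "enc q0 = 0"
begin

definition dec :: "nat \<Rightarrow> 'q" where "dec = inv_into Q enc"

lemma dec_enc [simp]: "q \<in> Q \<Longrightarrow> dec (enc q) = q"
  using enc by (simp add: dec_def bij_betw_def)

lemma dec_in: "n < card Q \<Longrightarrow> dec n \<in> Q"
  using enc by (auto simp: dec_def bij_betw_def intro!: inv_into_into)

lemma enc_less: "q \<in> Q \<Longrightarrow> enc q < card Q"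
  using enc by (auto simp: bij_betw_def)

text \<open>
  The index tape is a binary counter whose zero digits are written \<open>0\<close> in cell \<open>0\<close> but \<open>2\<close> in
  the cells that a carry has passed, so that the head finds its way back to cell \<open>0\<close>. State
  \<open>3 * enc q + c\<close> means: ready to read (\<open>c = 0\<close>), carrying (\<open>c = 1\<close>), returning (\<open>c = 2\<close>).
\<close>

definition counter_trans ::
  "nat \<Rightarrow> 'i option \<Rightarrow> nat list \<Rightarrow> (nat \<times> (nat \<times> move) list) option" where
  "counter_trans n a rs =
    (if n mod 3 = 0 then
       (case a of None \<Rightarrow> None
        | Some x \<Rightarrow> (case \<delta> (dec (n div 3)) x (rs ! 1) of (q', act) \<Rightarrow>
            if rs ! 0 = 1 then Some (3 * enc q' + 1, [(0, MoveR), act])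
            else Some (3 * enc q', [(1, Stay), act])))
     else if n mod 3 = 1 then
       (if rs ! 0 = 1 then Some (n, [(2, MoveR), (rs ! 1, Stay)])
        else Some (n + 1, [(1, MoveL), (rs ! 1, Stay)]))
     else
       (if rs ! 0 = 2 then Some (n, [(2, MoveL), (rs ! 1, Stay)])
        else Some (n - 2, [(rs ! 0, Stay), (rs ! 1, Stay)])))"

text \<open>Halting happens only in the ready phase, so accepting states are codes divisible by
  3.\<close>

definition M :: "'i rtm" where
  "M = \<lparr>num_states = 3 * card Q, num_symbols = m, num_tapes = 2,
        trans = counter_trans, accepting = (\<lambda>q. 3 * enc q) ` (F \<inter> Q)\<rparr>"

lemma M_sel [simp]:
  "num_states M = 3 * card Q" "num_symbols M = m" "num_tapes M = 2" "trans M = counter_trans"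
  "accepting M = (\<lambda>q. 3 * enc q) ` (F \<inter> Q)"
  by (simp_all add: M_def)

lemma rtm_wf_M: "rtm_wf \<Gamma> M"
proof -
  have "card Q > 0" using enc_less[OF q0] by simp
  moreover have "case counter_trans n a rs of None \<Rightarrow> True
         | Some (q', acts) \<Rightarrow> q' < 3 * card Q \<and> length acts = 2 \<and> (\<forall>(s, mv) \<in> set acts. s < m)"
    if n: "n < 3 * card Q" and a: "a \<in> insert None (Some ` \<Gamma>)"
      and rs: "rs \<in> lists {..<m}" "length rs = 2" for n a rs
  proof -
    from rs have r: "rs ! 0 < m" "rs ! 1 < m"
      by (auto simp: in_lists_conv_set subset_iff)
    have d: "dec (n div 3) \<in> Q" using n by (intro dec_in) auto
    consider "n mod 3 = 0" | "n mod 3 = 1" | "n mod 3 = 2" by linarith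
    then show ?thesis
    proof cases
      case 1
      show ?thesis
      proof (cases a)
        case None then show ?thesis using 1 by (simp add: counter_trans_def)
      next
        case (Some x)
        obtain q' s mv where e: "\<delta> (dec (n div 3)) x (rs ! 1) = (q', s, mv)"
          by (metis prod_cases3)
        have "q' \<in> Q \<and> s < m" using closed[OF d _ r(2) e] a Some by auto
        then show ?thesis using 1 Some e m enc_less[of q']
          by (auto simp: counter_trans_def)
      qed
    next
      case 2
      then have "n + 1 < 3 * card Q" using n by presburger
      then show ?thesis using 2 n r m by (auto simp: counter_trans_def)
    next
      case 3
      then show ?thesis using n r m by (auto simp: counter_trans_def)
    qed
  qed
  ultimately show ?thesis using m unfolding rtm_wf_def M_sel by simp
qed

section \<open>Steps of the simulating machine and incrementing the counter\<close>

lemma step_ready: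
  assumes "q \<in> Q" "input_at w (index_value (0, f)) = Some a"
    and "\<delta> q a (tape_read T) = (q', act)"
  shows "rtm_step M w (3 * enc q, [(0, f), T]) =
    (if f 0 = 1 then (Suc (3 * enc q'), [(1, f(0 := 0)), tape_act T act])
     else (3 * enc q', [(0, f(0 := 1)), tape_act T act]))"
  using assms by (simp add: rtm_step_def rtm_next_def counter_trans_def tape_read_def[of "(_, _)"])

lemma step_carry:
  "rtm_step M w (Suc (3 * e), [(j, f), T]) =
    (if f j = 1 then (Suc (3 * e), [(j + 1, f(j := 2)), T])
     else (Suc (Suc (3 * e)), [(j - 1, f(j := 1)), T]))"
  by (simp add: rtm_step_def rtm_next_def counter_trans_def tape_read_def[of "(_, _)"])

lemma step_return:
  "rtm_step M w (Suc (Suc (3 * e)), [(j, f), T]) =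
    (if f j = 2 then (Suc (Suc (3 * e)), [(j - 1, f), T]) else (3 * e, [(j, f), T]))"
  by (auto simp: rtm_step_def rtm_next_def counter_trans_def tape_read_def[of "(_, _)"])

text \<open>The head moves right in every step and never reads a cell that it has changed, so
  induction on the remaining distance works.\<close>

lemma run_carry:
  assumes "j \<le> r" "\<And>i. j \<le> i \<Longrightarrow> i < r \<Longrightarrow> f i = 1"
  shows "(rtm_step M w ^^ (r - j)) (Suc (3 * e), [(j, f), T]) =
    (Suc (3 * e), [(r, \<lambda>i. if j \<le> i \<and> i < r then 2 else f i), T])"
  using assms
proof (induction "r - j" arbitrary: j f)
  case 0
  then have "j = r" by simp
  then show ?case by (simp add: fun_eq_iff)
next
  case (Suc n)
  from Suc.hyps(2) have j: "j < r" "n = r - Suc j" by auto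
  have "(rtm_step M w ^^ (r - j)) (Suc (3 * e), [(j, f), T]) =
     (rtm_step M w ^^ (r - Suc j)) (Suc (3 * e), [(Suc j, f(j := 2)), T])"
    using j Suc.prems by (simp flip: Suc.hyps(2) add: funpow_Suc_right step_carry del: funpow.simps)
  also have "\<dots> = (Suc (3 * e), [(r, \<lambda>i. if Suc j \<le> i \<and> i < r then 2 else (f(j := 2)) i), T])"
    by (rule Suc.hyps(1)) (use j Suc.prems in auto)
  also have "(\<lambda>i. if Suc j \<le> i \<and> i < r then 2 else (f(j := 2)) i) = (\<lambda>i. if j \<le> i \<and> i < r then 2 else f i)"
    using j by (auto simp: fun_eq_iff)
  finally show ?case .
qed

text \<open>There are \<open>j\<close> moves to the left, and one more step in which cell 0 is
  recognized by not containing 2 and the state becomes ready.\<close>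

lemma run_return:
  assumes "\<And>i. 0 < i \<Longrightarrow> i \<le> j \<Longrightarrow> f i = 2" "f 0 \<noteq> 2"
  shows "(rtm_step M w ^^ Suc j) (Suc (Suc (3 * e)), [(j, f), T]) = (3 * e, [(0, f), T])"
  using assms
proof (induction j)
  case 0
  then show ?case using step_return[of w e 0 f T] by simp
next
  case (Suc j)
  have "(rtm_step M w ^^ Suc (Suc j)) (Suc (Suc (3 * e)), [(Suc j, f), T]) =
     (rtm_step M w ^^ Suc j) (Suc (Suc (3 * e)), [(j, f), T])"
    using Suc.prems(1)[of "Suc j"] step_return[of w e "Suc j" f T]
    by (simp only: funpow_Suc_right o_apply) simp
  also have "\<dots> = (3 * e, [(0, f), T])" by (rule Suc.IH) (use Suc.prems in auto)
  finally show ?case .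
qed

text \<open>The condition on cell 0 lets the head find its way back. Finiteness excludes the default
  value 0 of an infinite sum in \<open>index_value\<close>.\<close>

definition counter :: "(nat \<Rightarrow> nat) \<Rightarrow> nat \<Rightarrow> bool" where
  "counter f n \<longleftrightarrow> f 0 \<noteq> 2 \<and> finite {j. f j = 1} \<and> index_value (0, f) = n"

text \<open>The \<open>r\<close> lowest ones contribute \<open>2 ^ r - 1\<close> and are replaced by
  a single one of weight \<open>2 ^ r\<close>. The number of ones is the potential of the amortized
  analysis.\<close>

lemma counter_increment:
  assumes "counter f n" and r: "\<And>i. i < r \<Longrightarrow> f i = 1" "f r \<noteq> 1"
  defines "f' \<equiv> (\<lambda>i. if i = r then 1 else if i = 0 then 0 else if i < r then 2 else f i)"
  shows "counter f' (Suc n)" "card {j. f' j = 1} + r = Suc (card {j. f j = 1})"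
proof -
  let ?U = "{j. f j = 1 \<and> r < j}"
  have f0: "f 0 \<noteq> 2" and fin: "finite {j. f j = 1}" and n: "(\<Sum>j | f j = 1. 2 ^ j) = n"
    using assms(1) by (auto simp: counter_def index_value_def)
  have U: "finite ?U" by (rule finite_subset[OF _ fin]) auto
  have o: "{j. f j = 1} = {..<r} \<union> ?U"
    using r by (auto, metis nat_neq_iff)
  have o': "{j. f' j = 1} = insert r ?U"
    using r(2) by (auto simp: f'_def split: if_splits)
  have "(\<Sum>j | f j = 1. 2 ^ j) = (\<Sum>j<r. 2 ^ j) + (\<Sum>j\<in>?U. (2::nat) ^ j)"
    unfolding o using U by (subst sum.union_disjoint) auto
  moreover have "(\<Sum>j | f' j = 1. 2 ^ j) = 2 ^ r + (\<Sum>j\<in>?U. (2::nat) ^ j)"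
    unfolding o' using U by simp
  moreover have "(\<Sum>j<r. (2::nat) ^ j) + 1 = 2 ^ r"
    by (induction r) auto
  ultimately have "(\<Sum>j | f' j = 1. 2 ^ j) = Suc n" using n by simp
  moreover have "f' 0 \<noteq> 2" by (simp add: f'_def)
  ultimately show "counter f' (Suc n)" unfolding counter_def index_value_def using U o' by simp
  have "card {j. f j = 1} = r + card ?U"
    unfolding o using U by (subst card_Un_disjoint) auto
  moreover have "card {j. f' j = 1} = Suc (card ?U)" unfolding o' using U by simp
  ultimately show "card {j. f' j = 1} + r = Suc (card {j. f j = 1})" by simp
qed

text \<open>With \<open>r\<close> leading ones, \<open>2 * r + 1\<close> steps are made while the
  number of ones changes by \<open>1 - r\<close>. Weighting the ones by 2 makes the amortized cost
  3, whatever \<open>r\<close> is.\<close>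

lemma read_symbol:
  assumes f: "counter f n" and n: "n < length w" and q: "q \<in> Q"
    and \<delta>: "\<delta> q (w ! n) (tape_read T) = (q', act)"
  obtains t f' where "counter f' (Suc n)"
    "(rtm_step M w ^^ t) (3 * enc q, [(0, f), T]) = (3 * enc q', [(0, f'), tape_act T act])"
    "t + 2 * card {j. f' j = 1} = 3 + 2 * card {j. f j = 1}"
proof -
  have fin: "finite {j. f j = 1}" using f by (simp add: counter_def)
  then have "\<exists>j. f j \<noteq> 1" by (metis (mono_tags) UNIV_eq_I infinite_UNIV_nat mem_Collect_eq)
  define r where "r = (LEAST j. f j \<noteq> 1)"
  have r: "f r \<noteq> 1" unfolding r_def by (rule LeastI_ex) fact
  have r': "f i = 1" if "i < r" for i using not_less_Least that unfolding r_def by blast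
  define f' where "f' = (\<lambda>i. if i = r then 1 else if i = 0 then 0 else if i < r then 2 else f i)"
  have inc: "counter f' (Suc n)"
    unfolding f'_def by (rule counter_increment(1)[OF f r' r])
  have card: "card {j. f' j = 1} + r = Suc (card {j. f j = 1})"
    unfolding f'_def by (rule counter_increment(2)[OF f r' r])
  have inp: "input_at w (index_value (0, f)) = Some (w ! n)"
    using f n by (simp add: counter_def input_at_def)
  note ready = step_ready[OF q inp \<delta>]
  have "(rtm_step M w ^^ (2 * r + 1)) (3 * enc q, [(0, f), T]) = (3 * enc q', [(0, f'), tape_act T act])"
  proof (cases r)
    case 0
    then have "f' = f(0 := 1)" by (auto simp: f'_def)
    then show ?thesis using 0 r ready by simp
  next
    case (Suc r1)
    let ?T = "tape_act T act"
    let ?g = "f(0 := 0)"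
    let ?h = "\<lambda>i. if 1 \<le> i \<and> i < r then 2 else ?g i"
    have f0: "f 0 = 1" using r' Suc by simp
    have h: "?h(r := 1) = f'" using Suc by (auto simp: f'_def)
    \<comment> \<open>From right to left: one step reads the symbol and clears cell 0,
      \<open>r - 1\<close> steps carry, one step writes the new one and turns round, and
      \<open>r\<close> steps return.\<close>
    have "2 * r + 1 = Suc r1 + (1 + ((r - 1) + 1))" using Suc by simp
    then have "(rtm_step M w ^^ (2 * r + 1)) (3 * enc q, [(0, f), T]) =
      (rtm_step M w ^^ Suc r1) (rtm_step M w ((rtm_step M w ^^ (r - 1)) (rtm_step M w (3 * enc q, [(0, f), T]))))"
      by (simp only: funpow_add o_apply) simp
    also have "rtm_step M w (3 * enc q, [(0, f), T]) = (Suc (3 * enc q'), [(1, ?g), ?T])"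
      using ready f0 by simp
    also have "(rtm_step M w ^^ (r - 1)) \<dots> = (Suc (3 * enc q'), [(r, ?h), ?T])"
      by (rule run_carry) (use Suc r' in auto)
    also have "rtm_step M w \<dots> = (Suc (Suc (3 * enc q')), [(r1, f'), ?T])"
      using Suc r unfolding step_carry h by simp
    also have "(rtm_step M w ^^ Suc r1) \<dots> = (3 * enc q', [(0, f'), ?T])"
      by (rule run_return) (use Suc in \<open>auto simp: f'_def\<close>)
    finally show ?thesis .
  qed
  moreover have "(2 * r + 1) + 2 * card {j. f' j = 1} = 3 + 2 * card {j. f j = 1}"
    using card by simp
  ultimately show ?thesis using that inc by blast
qed

section \<open>Simulation of the one-way machine in linear time\<close>

definition final :: "'i list \<Rightarrow> 'q \<times> tape" where
  "final w = foldl (online_step \<delta>) (q0, (0, \<lambda>_. 0)) w"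

lemma final_closed:
  "w \<in> lists \<Gamma> \<Longrightarrow> fst (final w) \<in> Q \<and> (\<forall>j. snd (snd (final w)) j < m)"
proof (induction w rule: rev_induct)
  case Nil
  then show ?case using q0 m by (simp add: final_def)
next
  case (snoc a w)
  obtain q p f where e: "final w = (q, p, f)" by (metis prod_cases3)
  obtain q' s mv where d: "\<delta> q a (f p) = (q', s, mv)" by (metis prod_cases3)
  have IH: "q \<in> Q" "\<And>j. f j < m" using snoc e by auto
  have "q' \<in> Q \<and> s < m" using closed[OF IH(1) _ IH(2) d] snoc.prems by simp
  moreover have "final (w @ [a]) = online_step \<delta> (final w) a" by (simp add: final_def)
  ultimately show ?case using e d IH by (auto simp: tape_read_def)
qed

text \<open>The counter always equals the number of symbols read, hence addresses the next one. The
  time bound follows by telescoping the amortized costs.\<close>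

lemma simulation:
  assumes w: "w \<in> lists \<Gamma>" and "n \<le> length w"
  shows "\<exists>t f q T. final (take n w) = (q, T) \<and> counter f n \<and>
    rtm_run M w t = (3 * enc q, [(0, f), T]) \<and> t + 2 * card {j. f j = 1} = 3 * n"
  using assms(2)
proof (induction n)
  case 0
  have "rtm_run M w 0 = (3 * enc q0, [(0, \<lambda>_. 0), (0, \<lambda>_. 0)])"
    by (simp add: rtm_run_def rtm_init_def enc_q0 numeral_2_eq_2)
  moreover have "counter (\<lambda>_. 0) 0" by (simp add: counter_def index_value_def)
  ultimately show ?case by (force simp: final_def)
next
  case (Suc n)
  then obtain t f q T where IH: "final (take n w) = (q, T)" "counter f n"
    "rtm_run M w t = (3 * enc q, [(0, f), T])" "t + 2 * card {j. f j = 1} = 3 * n" by auto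
  obtain q' act where \<delta>: "\<delta> q (w ! n) (tape_read T) = (q', act)" by (metis surj_pair)
  have "take n w \<in> lists \<Gamma>" using w by (auto simp: in_lists_conv_set dest: in_set_takeD)
  then have q: "q \<in> Q" using final_closed[of "take n w"] IH(1) by simp
  obtain t' f' where t': "counter f' (Suc n)"
    "(rtm_step M w ^^ t') (3 * enc q, [(0, f), T]) = (3 * enc q', [(0, f'), tape_act T act])"
    "t' + 2 * card {j. f' j = 1} = 3 + 2 * card {j. f j = 1}"
    by (rule read_symbol[OF IH(2) _ q \<delta>]) (use Suc.prems in auto)
  have "rtm_run M w (t' + t) = (rtm_step M w ^^ t') (rtm_run M w t)"
    by (simp add: rtm_run_def funpow_add)
  then have "rtm_run M w (t' + t) = (3 * enc q', [(0, f'), tape_act T act])"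
    using IH(3) t'(2) by simp
  moreover have "final (take (Suc n) w) = (q', tape_act T act)"
    using IH(1) \<delta> Suc.prems by (simp add: take_Suc_conv_app_nth final_def)
  moreover have "t' + t + 2 * card {j. f' j = 1} = 3 * Suc n" using t'(3) IH(4) by simp
  ultimately show ?case using t'(1) by blast
qed

lemma online_language:
  assumes "finite \<Gamma>" "L \<subseteq> lists \<Gamma>" "\<And>w. w \<in> lists \<Gamma> \<Longrightarrow> w \<in> L \<longleftrightarrow> fst (final w) \<in> F"
  shows "L \<in> DLINTIME \<Gamma>"
proof -
  have "\<exists>t \<le> 3 * (length w + 1). rtm_next M w (rtm_run M w t) = None \<and>
      (fst (rtm_run M w t) \<in> accepting M \<longleftrightarrow> w \<in> L)" if w: "w \<in> lists \<Gamma>" for w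
  proof -
    from simulation[OF w order_refl] obtain t f q T where
      s: "final w = (q, T)" "counter f (length w)"
      "rtm_run M w t = (3 * enc q, [(0, f), T])" "t + 2 * card {j. f j = 1} = 3 * length w"
      by auto
    have q: "q \<in> Q" using final_closed[OF w] s by simp
    \<comment> \<open>The counter now points just past the input, so the machine sees
      \<open>None\<close> in a ready state.\<close>
    have "rtm_next M w (rtm_run M w t) = None"
      using s by (simp add: rtm_next_def counter_trans_def input_at_def counter_def)
    moreover have "3 * enc q \<in> accepting M \<longleftrightarrow> q \<in> F"
      using q dec_enc by auto (metis dec_enc)
    ultimately show ?thesis using s assms(3)[OF w] by (intro exI[of _ t]) auto
  qed
  then show ?thesis using assms(1,2) rtm_wf_M unfolding DLINTIME_def by blast
qed

end

lemma online_DLINTIME: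
  fixes \<delta> :: "'q \<Rightarrow> 'i \<Rightarrow> nat \<Rightarrow> 'q \<times> nat \<times> move"
  assumes "finite Q" "q0 \<in> Q" "3 \<le> m" "finite \<Gamma>" "L \<subseteq> lists \<Gamma>"
    and "\<And>q a r q' s mv. q \<in> Q \<Longrightarrow> a \<in> \<Gamma> \<Longrightarrow> r < m \<Longrightarrow> \<delta> q a r = (q', s, mv) \<Longrightarrow> q' \<in> Q \<and> s < m"
    and "\<And>w. w \<in> lists \<Gamma> \<Longrightarrow>
      w \<in> L \<longleftrightarrow> fst (foldl (online_step \<delta>) (q0, (0, \<lambda>_. 0)) w) \<in> F"
  shows "L \<in> DLINTIME \<Gamma>"
proof -
  obtain h where h: "bij_betw h Q {..<card Q}"
    using ex_bij_betw_finite_nat[OF assms(1)] by (auto simp: atLeast0LessThan)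
  \<comment> \<open>A transposition turns an arbitrary enumeration into one that gives
    \<open>q0\<close> the code 0.\<close>
  define swap where "swap n = (if n = h q0 then 0 else if n = 0 then h q0 else n)" for n
  define enc where "enc = swap \<circ> h"
  have "h q0 < card Q" using h assms(2) by (auto simp: bij_betw_def)
  then have "bij_betw swap {..<card Q} {..<card Q}"
    by (intro bij_betwI[where g = swap]) (auto simp: swap_def)
  then have "bij_betw enc Q {..<card Q}" unfolding enc_def using h by (rule bij_betw_trans[rotated])
  moreover have "enc q0 = 0" by (simp add: enc_def swap_def)
  ultimately interpret online_machine \<Gamma> Q m \<delta> q0 F enc
    using assms(2,3) by unfold_locales (assumption | rule assms(6))+
  show ?thesis by (rule online_language) (simp_all add: final_def assms(4,5,7))
qed

section \<open>The words and their letters\<close>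

lemma finite_letters [simp]: "finite S \<Longrightarrow> finite (letters S)"
  by (simp add: letters_def)

lemma letter_in_letters [simp]:
  "Gen s \<in> letters S \<longleftrightarrow> s \<in> S" "Inv s \<in> letters S \<longleftrightarrow> s \<in> S" "Unit \<in> letters S"
  by (auto simp: letters_def)

lemma inv_letter_in_letters [simp]: "inv_letter a \<in> letters S \<longleftrightarrow> a \<in> letters S"
  by (cases a) (auto simp: letters_def)

lemma inv_letter_inv_letter [simp]: "inv_letter (inv_letter a) = a"
  by (cases a) auto

section \<open>Binary positions in concatenated words\<close>

definition num :: "bool list \<Rightarrow> nat" where
  "num i = horner_sum of_bool 2 (rev i)"

lemma num_Nil [simp]: "num [] = 0"
  by (simp add: num_def)

text \<open>Splitting off leading bits is division with remainder by a power of two; this makes it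
  possible to read a position block by block.\<close>

lemma num_append: "num (i @ j) = num i * 2 ^ length j + num j"
  by (simp add: num_def horner_sum_append)

lemma num_less: "num i < 2 ^ length i"
proof (induction i rule: rev_induct)
  case (snoc b i)
  then show ?case by (cases b) (auto simp: num_append num_def[of "[_]"])
qed simp

lemma length_concat_map_const:
  "(\<And>a. a \<in> set w \<Longrightarrow> length (f a) = N) \<Longrightarrow> length (concat (map f w)) = length w * N"
  by (induction w) auto

lemma nth_concat_map_const:
  assumes "\<And>a. a \<in> set w \<Longrightarrow> length (f a) = N" "m < length w" "r < N"
  shows "concat (map f w) ! (m * N + r) = f (w ! m) ! r"
  using assms
proof (induction w arbitrary: m)
  case (Cons a w)
  then show ?case by (cases m) (auto simp: nth_append add.assoc)
qed simp

text \<open>The recursion is on the number of levels left, since the path grows.\<close>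

fun commutator_tree :: "(bool list \<Rightarrow> letter list) \<Rightarrow> nat \<Rightarrow> bool list \<Rightarrow> letter list" where
  "commutator_tree f 0 v = f v"
| "commutator_tree f (Suc n) v =
     commutator_word (commutator_tree f n (v @ [False])) (commutator_tree f n (v @ [True]))"

definition pad :: "nat \<Rightarrow> letter \<Rightarrow> letter list" where
  "pad q a = a # replicate (2 ^ q - 1) Unit"

text \<open>While the path is read, \<open>Path\<close> carries the current pair of letters. While
  the position is read, \<open>Index\<close> carries the flag of \<open>expand\<close>, the current
  letter and the bits of the unfinished block. \<open>Finish\<close> and \<open>Compare\<close>
  carry the letter found, before and after the last separator.\<close>

datatype scan_state =
  Start | Path "letter \<times> letter" | Index bool letter "bool list" | Finish letter | Compare letter
  | Accept | Reject

text \<open>Later \<open>\<sigma>\<close> places a letter at a vertex, \<open>\<rho>\<close>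
  translates generators of the branching subgroup into words over \<open>S\<close>, and the indices
  \<open>\<kappa>0\<close>, \<open>\<kappa>1\<close> stand for \<open>k\<close> and
  \<open>l\<close>. The letter \<open>a0\<close> is the whole word for depth 0.\<close>

locale leaf_words =
  fixes q :: nat and S' S :: "nat set"
    and \<sigma> \<rho> :: "letter \<Rightarrow> letter list"
    and \<kappa>0 \<kappa>1 :: nat and a0 :: letter
  assumes q: "0 < q" and finite: "finite S'" "finite S"
    and \<kappa>: "\<kappa>0 \<in> S'" "\<kappa>1 \<in> S'" and a0: "a0 \<in> letters S"
    and \<sigma>: "\<And>a. a \<in> letters S' \<Longrightarrow> \<sigma> a \<in> lists (letters S') \<and> length (\<sigma> a) = 2 ^ q"
    and \<rho>: "\<And>a. a \<in> letters S' \<Longrightarrow> \<rho> a \<in> lists (letters S) \<and> length (\<rho> a) = 2 ^ q"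
begin

text \<open>This is the passage from a node to its children with all placements forgotten, so only
  finitely many pairs occur. The placements are recovered from the path.\<close>

fun next_pair :: "letter \<times> letter \<Rightarrow> bool \<Rightarrow> letter \<times> letter" where
  "next_pair (a, b) c = (if c then (inv_letter b, Gen \<kappa>1) else (inv_letter a, Gen \<kappa>0))"

definition pair_at :: "bool list \<Rightarrow> letter \<times> letter" where
  "pair_at v = foldl next_pair (Gen \<kappa>0, Gen \<kappa>1) v"

text \<open>A leaf is an entry of the pair of its parent. The last step of \<open>pair_at\<close>
  has inverted that entry, which is undone here.\<close>

definition base :: "bool list \<Rightarrow> letter" where
  "base v = inv_letter (fst (pair_at v))"

definition block :: "bool \<Rightarrow> bool list \<Rightarrow> letter \<Rightarrow> letter list" where
  "block act u = (if u = [] then \<rho> else if act then \<sigma> else pad q)"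

text \<open>
  The path is traversed from its end. From the first bit \<open>1\<close> on, the blocks only pad by \<^const>\<open>Unit\<close>,
  which gives all leaves the same length; the block at the root translates into the letters over \<^term>\<open>S\<close>.
\<close>

fun expand :: "bool \<Rightarrow> bool list \<Rightarrow> letter list \<Rightarrow> letter list" where
  "expand act [] w = w"
| "expand act (b # u) w = expand (act \<and> \<not> b) u (concat (map (block (act \<and> \<not> b) u) w))"

definition leaf :: "bool list \<Rightarrow> letter list" where
  "leaf v = (if v = [] then [a0] else expand True (rev v) [base v])"

text \<open>Of the whole expansion, only the one letter above the wanted position is followed; this
  needs finite memory besides the path and the position.\<close>

fun letter_at :: "bool \<Rightarrow> bool list \<Rightarrow> letter \<Rightarrow> bool list \<Rightarrow> letter" where
  "letter_at act [] s i = s"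
| "letter_at act (b # u) s i =
     letter_at (act \<and> \<not> b) u (block (act \<and> \<not> b) u s ! num (take q i)) (drop q i)"

definition words :: "nat \<Rightarrow> bool list \<Rightarrow> letter list" where
  "words d v = commutator_tree leaf (d - length v) v"

section \<open>Lengths and letters of the leaves\<close>

lemma pair_at_in: "pair_at v \<in> letters S' \<times> letters S'"
proof (induction v rule: rev_induct)
  case Nil
  then show ?case using \<kappa> by (simp add: pair_at_def)
next
  case (snoc b v)
  obtain x y where e: "pair_at v = (x, y)" by (metis surj_pair)
  then have "pair_at (v @ [b]) = next_pair (x, y) b" by (simp add: pair_at_def)
  then show ?case using e snoc \<kappa> by auto
qed

lemma base_in: "base v \<in> letters S'"
  using pair_at_in[of v] by (auto simp: base_def)

lemma block_wf:
  assumes "a \<in> letters S'"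
  shows "length (block act u a) = 2 ^ q"
    "set (block act u a) \<subseteq> letters (if u = [] then S else S')"
  using assms \<sigma>[OF assms] \<rho>[OF assms] by (auto simp: block_def pad_def)

lemma concat_block_wf:
  assumes "w \<in> lists (letters S')"
  shows "length (concat (map (block act u) w)) = length w * 2 ^ q"
    "concat (map (block act u) w) \<in> lists (letters (if u = [] then S else S'))"
proof -
  have "set w \<subseteq> letters S'" using assms by auto
  then show "length (concat (map (block act u) w)) = length w * 2 ^ q"
    by (intro length_concat_map_const block_wf) auto
  have "set (concat (map (block act u) w)) \<subseteq> letters (if u = [] then S else S')"
    unfolding set_concat set_map using block_wf(2) \<open>set w \<subseteq> letters S'\<close> by fast
  then show "concat (map (block act u) w) \<in> lists (letters (if u = [] then S else S'))"
    unfolding lists_eq_set by simp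
qed

lemma expand_wf:
  assumes "w \<in> lists (letters (if u = [] then S else S'))"
  shows "expand act u w \<in> lists (letters S) \<and> length (expand act u w) = length w * 2 ^ (q * length u)"
  using assms
proof (induction act u w rule: expand.induct)
  case (2 act b u w)
  then have "w \<in> lists (letters S')" by simp
  note c = concat_block_wf[OF this, of "act \<and> \<not> b" u]
  show ?case using "2.IH"[OF c(2)] c(1) by (simp add: power_add)
qed simp

text \<open>All substitutes have length \<open>2 ^ q\<close>, so one substitution turns the index
  \<open>n\<close> into \<open>n * 2 ^ q\<close> plus the value of the next \<open>q\<close>
  bits.\<close>

lemma expand_nth:
  assumes "w \<in> lists (letters (if u = [] then S else S'))" "n < length w" "length i = q * length u"
  shows "expand act u w ! (n * 2 ^ (q * length u) + num i) = letter_at act u (w ! n) i"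
  using assms
proof (induction act u w arbitrary: n i rule: expand.induct)
  case (2 act b u w)
  then have w: "w \<in> lists (letters S')" by simp
  note c = concat_block_wf[OF this, of "act \<and> \<not> b" u]
  let ?w = "concat (map (block (act \<and> \<not> b) u) w)"
  let ?n = "n * 2 ^ q + num (take q i)"
  have l: "length (take q i) = q" "length (drop q i) = q * length u" using "2.prems" by auto
  then have lt: "num (take q i) < 2 ^ q" by (metis num_less)
  have "?n < Suc n * 2 ^ q" using lt by simp
  also have "\<dots> \<le> length w * 2 ^ q" using "2.prems" by (intro mult_right_mono) auto
  finally have n: "?n < length ?w" using c by simp
  have "num i = num (take q i) * 2 ^ (q * length u) + num (drop q i)"
    using l by (metis append_take_drop_id num_append)
  then have "n * 2 ^ (q * length (b # u)) + num i = ?n * 2 ^ (q * length u) + num (drop q i)"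
    by (simp add: algebra_simps power_add)
  then have "expand act (b # u) w ! (n * 2 ^ (q * length (b # u)) + num i) =
      letter_at (act \<and> \<not> b) u (?w ! ?n) (drop q i)"
    using "2.IH"[OF c(2) n l(2)] by simp
  also have "?w ! ?n = block (act \<and> \<not> b) u (w ! n) ! num (take q i)"
    by (rule nth_concat_map_const) (use block_wf w lt "2.prems" in \<open>auto simp: in_lists_conv_set\<close>)
  finally show ?case by simp
qed (simp add: num_def)

lemma leaf_wf: "leaf v \<in> lists (letters S)" "length (leaf v) = 2 ^ (q * length v)"
  using expand_wf[of "[base v]" "rev v" True] base_in[of v] a0 by (auto simp: leaf_def)

lemma leaf_nth:
  assumes "length i = q * length v" "v \<noteq> []"
  shows "leaf v ! num i = letter_at True (rev v) (base v) i"
  using expand_nth[of "[base v]" "rev v" 0 i True] assms base_in[of v] by (simp add: leaf_def)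

lemma words_leaf: "length v = d \<Longrightarrow> words d v = leaf v"
  by (simp add: words_def)

lemma words_node:
  "length v < d \<Longrightarrow> words d v = commutator_word (words d (v @ [False])) (words d (v @ [True]))"
  by (simp add: words_def Suc_diff_Suc[symmetric, of "length v"] del: diff_Suc_Suc)

lemma commutator_word_wf:
  "u \<in> lists (letters A) \<Longrightarrow> w \<in> lists (letters A) \<Longrightarrow> commutator_word u w \<in> lists (letters A)"
  by (auto simp: commutator_word_def inv_word_def)

lemma words_wf: "words d v \<in> lists (letters S)"
proof -
  have "commutator_tree leaf n v \<in> lists (letters S)" for n
    by (induction n arbitrary: v) (simp_all only: commutator_tree.simps leaf_wf(1) commutator_word_wf)
  then show ?thesis by (simp add: words_def)
qed

text \<open>
  The path is pushed on the work tape, as \<open>1\<close> and \<open>2\<close> for the two bits, and as \<open>3\<close> and \<open>4\<close> in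
  cell \<open>0\<close>. It is popped while the position is read, one bit of the path for each block of \<^term>\<open>q\<close>
  bits of the position.
\<close>

fun scan :: "scan_state \<Rightarrow> insym \<Rightarrow> nat \<Rightarrow> scan_state \<times> nat \<times> move" where
  "scan Start (Bit b) r = (Path (next_pair (Gen \<kappa>0, Gen \<kappa>1) b), if b then 4 else 3, MoveR)"
| "scan Start Sep r = (Finish a0, r, Stay)"
| "scan (Path p) (Bit b) r = (Path (next_pair p b), if b then 2 else 1, MoveR)"
| "scan (Path p) Sep r = (Index True (inv_letter (fst p)) [], r, MoveL)"
| "scan (Index act s i) (Bit x) r =
     (if length i + 1 < q then (Index act s (i @ [x]), r, Stay)
      else if r \<in> {3, 4} then (Finish (\<rho> s ! num (i @ [x])), r, Stay)
      else if act \<and> r = 1 then (Index True (\<sigma> s ! num (i @ [x])) [], r, MoveL)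
      else (Index False (pad q s ! num (i @ [x])) [], r, MoveL))"
| "scan (Finish s) Sep r = (Compare s, r, Stay)"
| "scan (Compare s) (Letter a) r = (if a = s then Accept else Reject, r, Stay)"
| "scan _ _ r = (Reject, r, Stay)"

section \<open>The language of the automaton\<close>

definition accepts :: "scan_state \<times> tape \<Rightarrow> insym list \<Rightarrow> bool" where
  "accepts c x \<longleftrightarrow> fst (foldl (online_step scan) c x) = Accept"

lemma accepts_Nil [simp]: "accepts c [] \<longleftrightarrow> fst c = Accept"
  by (simp add: accepts_def)

text \<open>The inputs accepted from each state are determined by this rule, working back from
  \<open>Accept\<close> to \<open>Start\<close>.\<close>

lemma accepts_Cons [simp]: "accepts c (a # x) \<longleftrightarrow> accepts (online_step scan c a) x"
  by (simp add: accepts_def)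

lemma accepts_Reject [simp]: "\<not> accepts (Reject, T) x"
  by (induction x arbitrary: T) auto

lemma accepts_Accept: "accepts (Accept, T) x \<longleftrightarrow> x = []"
  by (cases x) auto

lemma accepts_Compare: "accepts (Compare s, T) x \<longleftrightarrow> x = [Letter s]"
proof (cases x)
  case (Cons a y)
  then show ?thesis by (cases a) (auto simp: accepts_Accept)
qed simp

lemma accepts_Finish: "accepts (Finish s, T) x \<longleftrightarrow> x = [Sep, Letter s]"
proof (cases x)
  case (Cons a y)
  then show ?thesis by (cases a) (auto simp: accepts_Compare)
qed simp

definition cell :: "nat \<Rightarrow> bool \<Rightarrow> nat" where
  "cell j b = (if j = 0 then if b then 4 else 3 else if b then 2 else 1)"

text \<open>Cells from \<open>length v\<close> on are left arbitrary, because popping moves the head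
  but erases nothing.\<close>

definition holds :: "bool list \<Rightarrow> tape \<Rightarrow> bool" where
  "holds v T \<longleftrightarrow> (\<forall>j < length v. snd T j = cell j (v ! j))"

lemma map_Bit_simps:
  "map Bit i @ Sep # z = Bit x # y \<longleftrightarrow> (\<exists>i'. i = x # i' \<and> map Bit i' @ Sep # z = y)"
  "map Bit i @ Sep # z = Sep # y \<longleftrightarrow> i = [] \<and> z = y"
  "map Bit i @ Sep # z \<noteq> Letter a # y"
  "map Bit i @ Sep # z \<noteq> []"
  by (cases i; auto)+

lemma ex_map_Bit_Cons:
  "(\<exists>v i. map Bit v @ Sep # Z v i = Bit c # x \<and> P v i) \<longleftrightarrow>
   (\<exists>v i. map Bit v @ Sep # Z (c # v) i = x \<and> P (c # v) i)"
  unfolding map_Bit_simps by blast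

text \<open>Allowing a partial block \<open>p\<close> makes every input symbol one induction step. A
  full block selects a letter of the substitute and pops the last bit of \<open>v\<close>.\<close>

lemma accepts_Index:
  assumes "v \<noteq> []" "holds v T" "fst T = length v - 1" "length p < q"
  shows "accepts (Index act s p, T) x \<longleftrightarrow>
    (\<exists>i. map Bit i @ [Sep, Letter (letter_at act (rev v) s (p @ i))] = x \<and>
         length p + length i = q * length v)"
  using assms
proof (induction x arbitrary: act s p v T)
  case Nil
  then show ?case by simp
next
  case (Cons a x)
  obtain v' b where v: "v = v' @ [b]" using Cons.prems(1) by (cases v rule: rev_cases) auto
  have r: "tape_read T = cell (length v') b"
    using Cons.prems v by (simp add: tape_read_def holds_def)
  have stay: "tape_act T (cell (length v') b, Stay) = T" using tape_act_stay[of T] r by simp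
  \<comment> \<open>The position is still incomplete, so any symbol other than a bit is rightly
    rejected.\<close>
  have len: "length p < q * length v" using Cons.prems(4) v by simp
  show ?case
  proof (cases a)
    case (Bit c)
    have RHS: "(\<exists>i. map Bit i @ [Sep, Letter (letter_at act (rev v) s (p @ i))] = a # x \<and>
         length p + length i = q * length v) \<longleftrightarrow>
       (\<exists>i. map Bit i @ [Sep, Letter (letter_at act (rev v) s ((p @ [c]) @ i))] = x \<and>
         length (p @ [c]) + length i = q * length v)"
      unfolding Bit map_Bit_simps by auto
    show ?thesis
    proof (cases "length p + 1 < q")
      case True
      then have "online_step scan (Index act s p, T) a = (Index act s (p @ [c]), T)"
        by (simp add: Bit)
      then show ?thesis unfolding RHS using Cons.IH[of v T "p @ [c]" act s] Cons.prems True by simp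
    next
      case False
      then have q': "length (p @ [c]) = q" using Cons.prems by simp
      let ?n = "num (p @ [c])"
      \<comment> \<open>Here \<open>p @ [c]\<close> is exactly the block that
        \<open>letter_at\<close> splits off.\<close>
      have eq: "letter_at act (rev v) s ((p @ [c]) @ i) =
          letter_at (act \<and> \<not> b) (rev v') (block (act \<and> \<not> b) (rev v') s ! ?n) i" for i
      proof -
        have "take q ((p @ [c]) @ i) = p @ [c]" "drop q ((p @ [c]) @ i) = i"
          using q' by (metis append_eq_conv_conj)+
        moreover have "rev v = b # rev v'" by (simp add: v)
        ultimately show ?thesis by (simp only: letter_at.simps)
      qed
      show ?thesis
      proof (cases "v' = []")
        case True
        then have "online_step scan (Index act s p, T) a = (Finish (\<rho> s ! ?n), T)"
          using False r stay by (auto simp: Bit cell_def)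
        then show ?thesis unfolding RHS eq
          using True v q' by (auto simp: accepts_Finish block_def)
      next
        case nonempty: False
        define T' where "T' = tape_act T (tape_read T, MoveL)"
        have T': "holds v' T'" "fst T' = length v' - 1"
          using Cons.prems v by (cases T; auto simp: T'_def holds_def tape_read_def nth_append)+
        have "online_step scan (Index act s p, T) a =
            (Index (act \<and> \<not> b) (block (act \<and> \<not> b) (rev v') s ! ?n) [], T')"
          using False r nonempty by (auto simp: Bit T'_def cell_def block_def)
        then show ?thesis unfolding RHS eq
          using Cons.IH[OF nonempty T', of "[]" "act \<and> \<not> b"] q' q v by simp
      qed
    qed
  qed (use len in \<open>auto simp: map_Bit_simps\<close>)
qed

text \<open>While pushing, the head stands on the first free cell; the separator moves it back onto
  the last bit of the path.\<close>

lemma accepts_Path: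
  assumes "v \<noteq> []" "holds v T" "fst T = length v"
  shows "accepts (Path (pair_at v), T) x \<longleftrightarrow>
    (\<exists>v' i. map Bit v' @ Sep # map Bit i @
        [Sep, Letter (letter_at True (rev (v @ v')) (base (v @ v')) i)] = x \<and>
       length i = q * length (v @ v'))"
  using assms
proof (induction x arbitrary: v T)
  case Nil
  then show ?case by simp
next
  case (Cons a x)
  show ?case
  proof (cases a)
    case (Bit c)
    define T' where "T' = tape_act T (cell 1 c, MoveR)"
    have T': "holds (v @ [c]) T'" "fst T' = length (v @ [c])"
      using Cons.prems by (cases T; auto simp: T'_def holds_def nth_append cell_def)+
    have "online_step scan (Path (pair_at v), T) a = (Path (pair_at (v @ [c])), T')"
      by (simp add: Bit T'_def cell_def pair_at_def)
    then show ?thesis using Cons.IH[OF _ T'] unfolding Bit ex_map_Bit_Cons by simp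
  next
    case Sep
    define T' where "T' = tape_act T (tape_read T, MoveL)"
    have T': "holds v T'" "fst T' = length v - 1"
      using Cons.prems by (cases T; auto simp: T'_def holds_def tape_read_def)+
    have "online_step scan (Path (pair_at v), T) a = (Index True (base v) [], T')"
      by (simp add: Sep T'_def base_def)
    then show ?thesis using accepts_Index[OF Cons.prems(1) T', of "[]" True "base v" x] q
      by (auto simp: Sep map_Bit_simps)
  qed (auto simp: map_Bit_simps)
qed

lemma accepts_Start:
  "accepts (Start, (0, \<lambda>_. 0)) x \<longleftrightarrow>
    (\<exists>v i. map Bit v @ Sep # map Bit i @ [Sep, Letter (leaf v ! num i)] = x \<and>
       length i = q * length v)"
proof (cases x)
  case (Cons a y)
  show ?thesis
  proof (cases a)
    case (Bit c)
    define T where "T = tape_act (0, \<lambda>_. 0) (cell 0 c, MoveR)"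
    have "holds [c] T" "fst T = length [c]"
      by (auto simp: T_def holds_def)
    note P = accepts_Path[OF _ this]
    have "online_step scan (Start, (0, \<lambda>_. 0)) a = (Path (pair_at [c]), T)"
      by (simp add: Bit T_def cell_def pair_at_def)
    then have "accepts (Start, (0, \<lambda>_. 0)) x \<longleftrightarrow>
      (\<exists>v' i. map Bit v' @ Sep # map Bit i @
        [Sep, Letter (letter_at True (rev ([c] @ v')) (base ([c] @ v')) i)] = y \<and>
       length i = q * length ([c] @ v'))"
      using P[of y] Cons by simp
    also have "\<dots> \<longleftrightarrow> (\<exists>v' i. map Bit v' @ Sep # map Bit i @ [Sep, Letter (leaf (c # v') ! num i)] = y \<and>
       length i = q * length (c # v'))"
      using leaf_nth[of _ "c # _"] by (intro ex_cong1) auto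
    also have "\<dots> \<longleftrightarrow> (\<exists>v i. map Bit v @ Sep # map Bit i @ [Sep, Letter (leaf v ! num i)] = x \<and>
       length i = q * length v)"
      unfolding Cons Bit ex_map_Bit_Cons ..
    finally show ?thesis .
  next
    \<comment> \<open>The path is empty: the position has no bits and the only letter is
      \<open>a0\<close>.\<close>
    case Sep
    then show ?thesis using Cons by (auto simp: map_Bit_simps accepts_Finish leaf_def)
  qed (use Cons in \<open>auto simp: map_Bit_simps\<close>)
qed auto

text \<open>A full block is consumed at once, so at most \<open>q - 1\<close> bits are ever stored
  and the set is finite.\<close>

definition states :: "scan_state set" where
  "states = {Start, Accept, Reject} \<union> Path ` (letters S' \<times> letters S') \<union>
     (\<lambda>(act, s, i). Index act s i) ` (UNIV \<times> letters S' \<times> {i. set i \<subseteq> UNIV \<and> length i \<le> q - 1}) \<union>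
     Finish ` letters S \<union> Compare ` letters S"

lemma finite_states: "finite states"
  unfolding states_def using finite
  by (intro finite_UnI finite_imageI finite_cartesian_product finite_lists_length_le) auto

lemma in_states:
  "Start \<in> states" "Accept \<in> states" "Reject \<in> states"
  "Path p \<in> states \<longleftrightarrow> p \<in> letters S' \<times> letters S'"
  "Index act a i \<in> states \<longleftrightarrow> a \<in> letters S' \<and> length i < q"
  "Finish a \<in> states \<longleftrightarrow> a \<in> letters S"
  "Compare a \<in> states \<longleftrightarrow> a \<in> letters S"
  using q by (auto simp: states_def image_iff)

lemma next_pair_in:
  "p \<in> letters S' \<times> letters S' \<Longrightarrow> next_pair p b \<in> letters S' \<times> letters S'"
  using \<kappa> by (cases p) auto

lemma scan_closed:
  assumes "s \<in> states" "a \<in> insyms S" "r < 5" "scan s a r = (s', r', mv)"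
  shows "s' \<in> states \<and> r' < 5"
proof -
  have nth: "w ! n \<in> A" if "w \<in> lists A" "n < length w" for w :: "letter list" and A n
    using that by (auto simp: in_lists_conv_set)
  have \<sigma>_in: "\<sigma> x ! num i \<in> letters S'" "\<rho> x ! num i \<in> letters S" "pad q x ! num i \<in> letters S'"
    if "x \<in> letters S'" "length i = q" for x i
  proof -
    have n: "num i < 2 ^ q" using num_less[of i] that by simp
    show "\<sigma> x ! num i \<in> letters S'" by (rule nth) (use \<sigma> that n in auto)
    show "\<rho> x ! num i \<in> letters S" by (rule nth) (use \<rho> that n in auto)
    show "pad q x ! num i \<in> letters S'"
      by (rule nth) (use that n in \<open>auto simp: pad_def\<close>)
  qed
  show ?thesis
  proof (cases s)
    case Start
    then show ?thesis using assms(3,4) a0 \<kappa>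
      by (cases a) (auto simp: in_states split: if_splits)
  next
    case (Path p)
    then have p: "p \<in> letters S' \<times> letters S'" using assms(1) by (simp add: in_states)
    then have "inv_letter (fst p) \<in> letters S'" by auto
    then show ?thesis using Path assms(3,4) q next_pair_in[OF p]
      by (cases a) (auto simp: in_states simp del: next_pair.simps)
  next
    case (Index act x i)
    then have x: "x \<in> letters S'" "length i < q" using assms(1) by (auto simp: in_states)
    have "length (i @ [b]) = q" if "\<not> length i + 1 < q" for b using that x by simp
    then show ?thesis using Index assms(3,4) x q \<sigma>_in[OF x(1), of "i @ [_]"]
      by (cases a) (auto simp: in_states split: if_splits)
  next
    case (Finish x)
    then show ?thesis using assms by (cases a) (auto simp: in_states)
  next
    case (Compare x)
    then show ?thesis using assms(3,4) by (cases a) (auto simp: in_states split: if_splits)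
  qed (use assms in \<open>auto simp: in_states\<close>)
qed

lemma letter_language_words:
  "letter_language S q words \<in> DLINTIME (insyms S)"
proof (rule online_DLINTIME[where Q = states and ?q0.0 = Start and m = 5 and \<delta> = scan and F = "{Accept}"])
  show "finite (insyms S)" using finite by (simp add: insyms_def)
  show "letter_language S q words \<subseteq> lists (insyms S)"
    by (auto simp: letter_language_def insyms_def)
  show "w \<in> letter_language S q words \<longleftrightarrow>
      fst (foldl (online_step scan) (Start, (0, \<lambda>_. 0)) w) \<in> {Accept}" if "w \<in> lists (insyms S)" for w
  proof -
    have "leaf v ! num i \<in> letters S" if "length i = q * length v" for v i
      using leaf_wf[of v] num_less[of i] that by (auto simp: in_lists_conv_set)
    then have "w \<in> letter_language S q words \<longleftrightarrow> accepts (Start, (0, \<lambda>_. 0)) w"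
      unfolding accepts_Start letter_language_def num_def by (auto simp: words_leaf)
    then show ?thesis by (simp add: accepts_def)
  qed
qed (assumption | rule scan_closed finite_states in_states(1) | simp)+

end


section \<open>Tree automorphisms\<close>

text \<open>In the presence of the group syntax, \<open>inv\<close> does not denote the inverse of a function.\<close>

abbreviation inv_fun :: "('a \<Rightarrow> 'b) \<Rightarrow> 'b \<Rightarrow> 'a" where
  "inv_fun \<equiv> inv_into UNIV"

text \<open>The image of a child is adjacent to the image of its parent. It is not the vertex above,
  which by induction is already the image of the grandparent, and \<open>g\<close> is
  injective.\<close>

lemma tree_aut_snoc:
  assumes g: "tree_aut g"
  shows "\<exists>y. g (v @ [x]) = g v @ [y]"
proof (induction v arbitrary: x rule: rev_induct)
  case Nil
  have "tree_adj [] [x]" by (simp add: tree_adj_def)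
  then have "tree_adj [] (g [x])" using g unfolding tree_aut_def by metis
  moreover have "g [] = []" using g by (simp add: tree_aut_def)
  ultimately show ?case by (simp add: tree_adj_def)
next
  case (snoc z v)
  have "tree_adj (g (v @ [z])) (g ((v @ [z]) @ [x]))"
    using g unfolding tree_aut_def tree_adj_def by blast
  moreover have "g (v @ [z]) \<noteq> g ((v @ [z]) @ [x]) @ [y]" for y
  proof
    assume "g (v @ [z]) = g ((v @ [z]) @ [x]) @ [y]"
    then have "g v = g ((v @ [z]) @ [x])" using snoc[of z] by auto
    then have "v = (v @ [z]) @ [x]" using g by (metis tree_aut_def bij_pointE)
    then show False by simp
  qed
  ultimately show ?case by (auto simp: tree_adj_def)
qed

lemma tree_aut_append:
  assumes "tree_aut g"
  shows "\<exists>w'. length w' = length w \<and> g (v @ w) = g v @ w'"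
proof (induction w rule: rev_induct)
  case (snoc x w)
  then obtain w' where "length w' = length w" "g (v @ w) = g v @ w'" by auto
  moreover obtain y where "g ((v @ w) @ [x]) = g (v @ w) @ [y]" using tree_aut_snoc[OF assms] by blast
  ultimately show ?case by (intro exI[of _ "w' @ [y]"]) simp
qed simp

lemma tree_aut_Nil: "tree_aut g \<Longrightarrow> g [] = []"
  by (simp add: tree_aut_def)

lemma tree_aut_bij: "tree_aut g \<Longrightarrow> bij g"
  by (simp add: tree_aut_def)

lemma tree_aut_length [simp]: "tree_aut g \<Longrightarrow> length (g v) = length v"
  using tree_aut_append[of g v "[]"] by (auto simp: tree_aut_Nil)

lemma tree_aut_take: "tree_aut g \<Longrightarrow> take n (g w) = g (take n w)"
proof -
  assume g: "tree_aut g"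
  obtain w' where w': "length w' = length (drop n w)" "g (take n w @ drop n w) = g (take n w) @ w'"
    using tree_aut_append[OF g] by blast
  then have "g w = g (take n w) @ w'" by simp
  then show ?thesis using w'(1) g by (cases "n \<le> length w") auto
qed

lemma tree_aut_id: "tree_aut id"
  by (simp add: tree_aut_def)

lemma tree_aut_comp: "tree_aut g \<Longrightarrow> tree_aut h \<Longrightarrow> tree_aut (g \<circ> h)"
  by (simp add: tree_aut_def bij_comp)

lemma tree_aut_inv: "tree_aut g \<Longrightarrow> tree_aut (inv_fun g)"
  unfolding tree_aut_def by (metis bij_imp_bij_inv bij_inv_eq_iff)

lemma group_tree_aut_group: "group tree_aut_group"
proof (rule groupI)
  fix g :: "'a list \<Rightarrow> 'a list"
  assume "g \<in> carrier tree_aut_group"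
  then have g: "tree_aut g" by (simp add: tree_aut_group_def)
  then have "g \<circ> inv_fun g = id" by (simp add: tree_aut_bij bij_is_surj surj_iff[symmetric])
  then show "\<exists>h\<in>carrier tree_aut_group. h \<otimes>\<^bsub>tree_aut_group\<^esub> g = \<one>\<^bsub>tree_aut_group\<^esub>"
    using tree_aut_inv[OF g] by (auto simp: tree_aut_group_def)
qed (auto simp: tree_aut_group_def tree_aut_id tree_aut_comp comp_assoc)

lemma inv_tree_aut_group: "tree_aut g \<Longrightarrow> inv\<^bsub>tree_aut_group\<^esub> g = inv_fun g"
proof -
  assume g: "tree_aut g"
  interpret group tree_aut_group by (rule group_tree_aut_group)
  have "g \<circ> inv_fun g = id" using g by (simp add: tree_aut_bij bij_is_surj surj_iff[symmetric])
  then show ?thesis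
    using g tree_aut_inv[OF g] by (intro inv_equality) (auto simp: tree_aut_group_def)
qed

section \<open>Commutators of placed automorphisms\<close>

definition comm :: "('b \<Rightarrow> 'b) \<Rightarrow> ('b \<Rightarrow> 'b) \<Rightarrow> 'b \<Rightarrow> 'b" where
  "comm g h = h \<circ> g \<circ> inv_fun h \<circ> inv_fun g"

text \<open>Built from \<open>place_at\<close>, so that closure of \<open>K\<close> at the first
  level extends to all vertices.\<close>

definition place :: "'x list \<Rightarrow> ('x list \<Rightarrow> 'x list) \<Rightarrow> 'x list \<Rightarrow> 'x list" where
  "place v g = foldr place_at v g"

lemma place_apply:
  "place v g w = (if take (length v) w = v then v @ g (drop (length v) w) else w)"
proof (induction v arbitrary: w)
  case (Cons x v)
  then show ?case by (cases w) (auto simp: place_def)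
qed (simp add: place_def)

lemma place_append [simp]: "place v g (v @ w) = v @ g w"
  by (simp add: place_apply)

lemma place_other: "take (length v) w \<noteq> v \<Longrightarrow> place v g w = w"
  by (simp add: place_apply)

lemma place_id [simp]: "place v id = id"
  by (auto simp: fun_eq_iff place_apply) (metis append_take_drop_id)

lemma place_comp: "place v (g \<circ> h) = place v g \<circ> place v h"
  by (simp add: fun_eq_iff place_apply)

lemma place_inv:
  assumes "bij g"
  shows "inv_fun (place v g) = place v (inv_fun g)"
proof (rule inv_unique_comp)
  show "place v g \<circ> place v (inv_fun g) = id"
    using assms by (metis place_comp place_id bij_is_surj surj_iff)
  show "place v (inv_fun g) \<circ> place v g = id"
    using assms by (metis place_comp place_id bij_is_inj inj_iff)
qed

lemma place_bij: "bij g \<Longrightarrow> bij (place v g)"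
proof -
  assume "bij g"
  then have "place v g \<circ> place v (inv_fun g) = id" "place v (inv_fun g) \<circ> place v g = id"
    by (metis place_comp place_id bij_is_surj surj_iff bij_is_inj inj_iff)+
  then show ?thesis by (metis o_bij)
qed

lemma place_comm: "bij g \<Longrightarrow> bij h \<Longrightarrow> place v (comm g h) = comm (place v g) (place v h)"
  by (simp add: comm_def place_comp place_inv)

lemma bij_comm: "bij g \<Longrightarrow> bij h \<Longrightarrow> bij (comm g h)"
  by (simp add: comm_def bij_comp bij_imp_bij_inv)

lemma place_eq_id: "place v g = id \<longleftrightarrow> g = id"
proof
  assume "place v g = id"
  then have "v @ g w = v @ w" for w by (metis place_append id_apply)
  then show "g = id" by (simp add: fun_eq_iff)
qed simp

text \<open>\<open>A\<close> is \<open>place v g\<close> followed by the conjugate of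
  \<open>place v (inv_fun g)\<close> by \<open>k\<close>. The conjugate is supported below
  \<open>k v\<close>, and the two supports are disjoint.\<close>

lemma comm_place_inv:
  assumes g: "tree_aut g" and k: "tree_aut k" and v: "k v \<noteq> v"
  defines "A \<equiv> comm (place v (inv_fun g)) k"
  shows "bij A" "A (v @ w) = v @ g w"
    "take (length v) w = k v \<Longrightarrow> take (length v) (A w) = k v"
    "take (length v) w \<noteq> v \<Longrightarrow> take (length v) w \<noteq> k v \<Longrightarrow> A w = w"
proof -
  have bij: "bij g" "bij k" using g k by (auto dest: tree_aut_bij)
  have A: "A w = k (place v (inv_fun g) (inv_fun k (place v g w)))" for w
    using bij by (simp add: A_def comm_def place_inv bij_imp_bij_inv inv_inv_eq)
  have kk [simp]: "k (inv_fun k w) = w" "inv_fun k (k w) = w" for w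
    using bij by (auto simp: bij_is_surj surj_f_inv_f bij_is_inj)
  have ik: "tree_aut (inv_fun k)" using k by (rule tree_aut_inv)
  have v': "inv_fun k v \<noteq> v" using v by (metis kk(1))
  show "bij A" unfolding A_def using bij by (simp add: bij_comm place_bij bij_imp_bij_inv)
  have "take (length v) (inv_fun k (v @ g w)) \<noteq> v" using v' by (simp add: tree_aut_take[OF ik])
  then show "A (v @ w) = v @ g w" by (simp add: A place_other)
  show "take (length v) (A w) = k v" if w: "take (length v) w = k v"
  proof -
    have "place v g w = w" using w v by (simp add: place_other)
    moreover have "take (length v) (inv_fun k w) = v" by (simp add: tree_aut_take[OF ik] w)
    then obtain y where "inv_fun k w = v @ y" by (metis append_take_drop_id)
    ultimately show ?thesis by (simp add: A tree_aut_take[OF k])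
  qed
  show "A w = w" if w: "take (length v) w \<noteq> v" "take (length v) w \<noteq> k v"
  proof -
    have "inv_fun k (take (length v) w) \<noteq> v" using w(2) by (metis kk(1))
    then have "take (length v) (inv_fun k w) \<noteq> v" by (simp add: tree_aut_take[OF ik])
    then show ?thesis using w(1) by (simp add: A place_other)
  qed
qed

text \<open>This identifies a commutator without computing inverses of \<open>a\<close> and
  \<open>b\<close>.\<close>

lemma comm_unique:
  assumes "bij a" "bij b" "f \<circ> (a \<circ> b) = b \<circ> a"
  shows "f = comm a b"
proof -
  have "f \<circ> (a \<circ> b) \<circ> (inv_fun b \<circ> inv_fun a) = f"
    using assms(1,2) by (simp add: fun_eq_iff bij_is_surj surj_f_inv_f)
  then show ?thesis using assms(3) by (simp add: comm_def comp_assoc)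
qed

text \<open>Only below \<open>v\<close> do both inner commutators act, as \<open>g\<close> and
  \<open>h\<close>. Below \<open>k v\<close> and \<open>l v\<close> just one of them moves anything,
  so there they commute.\<close>

lemma comm_comm_place:
  assumes aut: "tree_aut g" "tree_aut h" "tree_aut k" "tree_aut l"
    and v: "k v \<noteq> v" "l v \<noteq> v" "k v \<noteq> l v"
  shows "comm (comm (place v (inv_fun g)) k) (comm (place v (inv_fun h)) l) = place v (comm g h)"
proof (rule comm_unique[symmetric])
  let ?a = "comm (place v (inv_fun g)) k" and ?b = "comm (place v (inv_fun h)) l"
  note a = comm_place_inv[OF aut(1,3) v(1)] and b = comm_place_inv[OF aut(2,4) v(2)]
  show "bij ?a" "bij ?b" by (fact a b)+
  have bij: "bij g" "bij h" using aut by (auto dest: tree_aut_bij)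
  show "place v (comm g h) \<circ> (?a \<circ> ?b) = ?b \<circ> ?a"
  proof
    fix w :: "'a list"
    let ?t = "take (length v) w"
    consider "\<exists>w'. w = v @ w'" | "?t = k v" | "?t = l v" | "?t \<noteq> v" "?t \<noteq> k v" "?t \<noteq> l v"
      by (metis append_take_drop_id)
    then show "(place v (comm g h) \<circ> (?a \<circ> ?b)) w = (?b \<circ> ?a) w"
    proof cases
      case 1
      moreover have "comm g h (g (h x)) = h (g x)" for x
        using bij by (simp add: comm_def bij_is_inj)
      ultimately show ?thesis by (auto simp: a(2) b(2))
    next
      case 2
      then show ?thesis using a(3)[of w] b(4)[of w] b(4)[of "?a w"] v by (simp add: place_other)
    next
      case 3
      then show ?thesis using b(3)[of w] a(4)[of w] a(4)[of "?b w"] v by (simp add: place_other)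
    next
      case 4
      then show ?thesis by (simp add: a(4) b(4) place_other)
    qed
  qed
qed

text \<open>The vertex \<open>u @ u\<close> is a witness: \<open>inv_fun k\<close> takes it out of
  the subtree at \<open>u\<close>, where the placed inverse is trivial, \<open>k\<close> brings it
  back, and the placed \<open>k\<close> moves it to \<open>u @ k u\<close>.\<close>

lemma comm_place_neq_id:
  assumes k: "tree_aut k" and u: "k u \<noteq> u"
  shows "comm k (place u k) \<noteq> id"
proof
  assume "comm k (place u k) = id"
  then have "comm k (place u k) (u @ u) = u @ u" by simp
  moreover have ik: "tree_aut (inv_fun k)" using k by (rule tree_aut_inv)
  moreover have bij: "bij k" using k by (rule tree_aut_bij)
  have kk: "k (inv_fun k w) = w" for w using bij by (simp add: bij_is_surj surj_f_inv_f)
  have "inv_fun k u \<noteq> u" using u kk by metis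
  then have "take (length u) (inv_fun k (u @ u)) \<noteq> u" by (simp add: tree_aut_take[OF ik])
  then have "comm k (place u k) (u @ u) = u @ k u"
    using bij by (simp add: comm_def place_inv place_other kk)
  ultimately show False using u by simp
qed


section \<open>Values of words\<close>

context group
begin

context
  fixes S :: "nat set" and \<nu> :: "nat \<Rightarrow> 'a"
  assumes \<nu>: "\<nu> ` S \<subseteq> carrier G"
begin

lemma letter_value_closed: "a \<in> letters S \<Longrightarrow> letter_value G \<nu> a \<in> carrier G"
  using \<nu> by (cases a) auto

lemma word_value_closed: "w \<in> lists (letters S) \<Longrightarrow> word_value G \<nu> w \<in> carrier G"
  by (induction w) (auto simp: word_value_def letter_value_closed)

lemma word_value_append:
  "u \<in> lists (letters S) \<Longrightarrow> w \<in> lists (letters S) \<Longrightarrow>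
    word_value G \<nu> (u @ w) = word_value G \<nu> u \<otimes> word_value G \<nu> w"
proof (induction u)
  case Nil
  then show ?case using word_value_closed by (simp add: word_value_def)
next
  case (Cons a u)
  then show ?case
    using word_value_closed[of u] word_value_closed[of w] letter_value_closed[of a]
    by (simp add: word_value_def m_assoc)
qed

lemma word_value_single: "a \<in> letters S \<Longrightarrow> word_value G \<nu> [a] = letter_value G \<nu> a"
  by (simp add: word_value_def letter_value_closed)

lemma word_value_Units: "word_value G \<nu> (replicate n Unit) = \<one>"
  by (induction n) (auto simp: word_value_def)

lemma letter_value_inv_letter:
  "a \<in> letters S \<Longrightarrow> letter_value G \<nu> (inv_letter a) = inv (letter_value G \<nu> a)"
  using \<nu> by (cases a) (auto simp: image_subset_iff)

lemma inv_word_in: "w \<in> lists (letters S) \<Longrightarrow> inv_word w \<in> lists (letters S)"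
  by (auto simp: inv_word_def)

lemma word_value_inv_word:
  "w \<in> lists (letters S) \<Longrightarrow> word_value G \<nu> (inv_word w) = inv (word_value G \<nu> w)"
proof (induction w)
  case Nil
  then show ?case by (simp add: inv_word_def word_value_def)
next
  case (Cons a w)
  then have a: "a \<in> letters S" and w: "w \<in> lists (letters S)" by auto
  have "inv_word (a # w) = inv_word w @ [inv_letter a]" by (simp add: inv_word_def)
  then have "word_value G \<nu> (inv_word (a # w)) = inv (word_value G \<nu> w) \<otimes> inv (letter_value G \<nu> a)"
    using a Cons.IH[OF w] inv_word_in[OF w]
    by (simp add: word_value_append word_value_single letter_value_inv_letter)
  also have "\<dots> = inv (letter_value G \<nu> a \<otimes> word_value G \<nu> w)"
    using a w by (simp add: inv_mult_group letter_value_closed word_value_closed)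
  finally show ?case by (simp add: word_value_def)
qed

lemma word_value_commutator_word:
  assumes "u \<in> lists (letters S)" "w \<in> lists (letters S)"
  shows "word_value G \<nu> (commutator_word u w) =
    inv (word_value G \<nu> u) \<otimes> (inv (word_value G \<nu> w) \<otimes> (word_value G \<nu> u \<otimes> word_value G \<nu> w))"
proof -
  have "inv_word w @ u @ w \<in> lists (letters S)" "u @ w \<in> lists (letters S)"
    using assms inv_word_in[of w] by auto
  then show ?thesis
    using assms by (simp add: commutator_word_def word_value_append word_value_inv_word inv_word_in)
qed

lemma generate_word:
  "x \<in> generate G (\<nu> ` S) \<Longrightarrow> \<exists>w \<in> lists (letters S). word_value G \<nu> w = x"
proof (induction x rule: generate.induct)
  case one
  show ?case by (rule bexI[of _ "[]"]) (auto simp: word_value_def)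
next
  case (incl h)
  then obtain s where "s \<in> S" "h = \<nu> s" by auto
  then show ?case by (intro bexI[of _ "[Gen s]"]) (auto simp: word_value_single)
next
  case (inv h)
  then obtain s where "s \<in> S" "h = \<nu> s" by auto
  then show ?case by (intro bexI[of _ "[Inv s]"]) (auto simp: word_value_single)
next
  case (eng h1 h2)
  then obtain w1 w2 where "w1 \<in> lists (letters S)" "word_value G \<nu> w1 = h1"
    "w2 \<in> lists (letters S)" "word_value G \<nu> w2 = h2" by auto
  then show ?case by (intro bexI[of _ "w1 @ w2"]) (auto simp: word_value_append)
qed

lemma substitution_exists:
  assumes "generate G (\<nu> ` S) = carrier G" "finite A" "f ` A \<subseteq> carrier G"
  obtains N where "\<And>q. N \<le> q \<Longrightarrow> \<exists>\<sigma>. \<forall>a\<in>A. \<sigma> a \<in> lists (letters S) \<and>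
    length (\<sigma> a :: letter list) = 2 ^ q \<and> word_value G \<nu> (\<sigma> a) = f a"
proof -
  have "\<forall>a\<in>A. \<exists>w \<in> lists (letters S). word_value G \<nu> w = f a"
    using generate_word assms(1,3) by blast
  then obtain W where W: "\<And>a. a \<in> A \<Longrightarrow> W a \<in> lists (letters S) \<and> word_value G \<nu> (W a) = f a"
    by metis
  obtain N where N: "\<And>a. a \<in> A \<Longrightarrow> length (W a) \<le> N"
    using finite_nat_set_iff_bounded_le[of "(\<lambda>a. length (W a)) ` A"] assms(2) by auto
  show ?thesis
  proof (rule that)
    fix q assume "N \<le> q"
    let ?\<sigma> = "\<lambda>a. W a @ replicate (2 ^ q - length (W a)) Unit"
    have "?\<sigma> a \<in> lists (letters S) \<and> length (?\<sigma> a) = 2 ^ q \<and> word_value G \<nu> (?\<sigma> a) = f a"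
      if a: "a \<in> A" for a
    proof -
      have "length (W a) \<le> 2 ^ q" using N[OF a] \<open>N \<le> q\<close> less_exp[of q] by linarith
      moreover have "replicate (2 ^ q - length (W a)) Unit \<in> lists (letters S)" by auto
      ultimately show ?thesis using W[OF a] assms(3) a
        by (auto simp: word_value_append word_value_Units)
    qed
    then show "\<exists>\<sigma>. \<forall>a\<in>A. \<sigma> a \<in> lists (letters S) \<and>
      length (\<sigma> a :: letter list) = 2 ^ q \<and> word_value G \<nu> (\<sigma> a) = f a"
      by (intro exI[of _ ?\<sigma>]) blast
  qed
qed

end

end

text \<open>It is applied with \<open>\<phi>\<close> placing at \<open>V\<close> inside
  \<open>K\<close>, and with \<open>\<phi>\<close> the inclusion of \<open>K\<close> into
  \<open>H\<close>.\<close>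

lemma word_value_substitution:
  assumes G: "group G" "\<nu> ` S \<subseteq> carrier G" and H: "group H" "\<nu>' ` S' \<subseteq> carrier H"
    and w: "w \<in> lists (letters S)"
    and f: "\<And>a. a \<in> letters S \<Longrightarrow>
      f a \<in> lists (letters S') \<and> word_value H \<nu>' (f a) = \<phi> (letter_value G \<nu> a)"
    and \<phi>: "\<And>x y. x \<in> carrier G \<Longrightarrow> y \<in> carrier G \<Longrightarrow> \<phi> (x \<otimes>\<^bsub>G\<^esub> y) = \<phi> x \<otimes>\<^bsub>H\<^esub> \<phi> y"
      "\<phi> \<one>\<^bsub>G\<^esub> = \<one>\<^bsub>H\<^esub>"
  shows "word_value H \<nu>' (concat (map f w)) = \<phi> (word_value G \<nu> w)"
  using w
proof (induction w rule: list.induct)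
  case Nil
  then show ?case using \<phi> by (simp add: word_value_def)
next
  case (Cons a w)
  then have a: "a \<in> letters S" and w: "w \<in> lists (letters S)" by auto
  have "concat (map f w) \<in> lists (letters S')" using w f by (induction w rule: list.induct) auto
  then have "word_value H \<nu>' (concat (map f (a # w))) =
      \<phi> (letter_value G \<nu> a) \<otimes>\<^bsub>H\<^esub> \<phi> (word_value G \<nu> w)"
    using f[OF a] Cons.IH[OF w] by (simp add: group.word_value_append[OF H])
  also have "\<dots> = \<phi> (letter_value G \<nu> a \<otimes>\<^bsub>G\<^esub> word_value G \<nu> w)"
    using \<phi>(1) group.letter_value_closed[OF G a] group.word_value_closed[OF G w] by simp
  finally show ?case by (simp add: word_value_def)
qed


section \<open>The commutator trees\<close>

abbreviation aut_subgroup :: "('x list \<Rightarrow> 'x list) set \<Rightarrow> ('x list \<Rightarrow> 'x list) monoid" where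
  "aut_subgroup H \<equiv> tree_aut_group\<lparr>carrier := H\<rparr>"

lemma tree_aut_group_simps [simp]:
  "g \<otimes>\<^bsub>tree_aut_group\<^esub> h = h \<circ> g" "\<one>\<^bsub>tree_aut_group\<^esub> = id"
  by (simp_all add: tree_aut_group_def)

lemma subgroup_tree_aut: "subgroup H tree_aut_group \<Longrightarrow> g \<in> H \<Longrightarrow> tree_aut g"
  using subgroup.subset by (force simp: tree_aut_group_def)

lemma group_aut_subgroup: "subgroup H tree_aut_group \<Longrightarrow> group (aut_subgroup H)"
  by (rule subgroup.subgroup_is_group[OF _ group_tree_aut_group])

lemma inv_aut_subgroup:
  "subgroup H tree_aut_group \<Longrightarrow> g \<in> H \<Longrightarrow> inv\<^bsub>aut_subgroup H\<^esub> g = inv_fun g"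
  by (metis group.m_inv_consistent group_tree_aut_group inv_tree_aut_group subgroup_tree_aut)

lemma inv_fun_in:
  "subgroup H tree_aut_group \<Longrightarrow> g \<in> H \<Longrightarrow> inv_fun g \<in> H"
  using subgroup.m_inv_closed inv_tree_aut_group subgroup_tree_aut by metis

text \<open>\<open>moves\<close> is what \<open>comm_comm_place\<close> asks of \<open>V\<close>.
  Non-triviality of the root comes from \<open>comm_neq_id\<close> for positive depth and from
  \<open>a0_value\<close> for depth 0.\<close>

locale branching_words = leaf_words q S' S \<sigma> \<rho> \<kappa>0 \<kappa>1 a0
  for q S' S \<sigma> \<rho> \<kappa>0 \<kappa>1 a0 +
  fixes K H :: "('x list \<Rightarrow> 'x list) set" and \<nu>' \<nu> :: "nat \<Rightarrow> 'x list \<Rightarrow> 'x list"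
    and V :: "'x list"
  assumes K: "subgroup K tree_aut_group" and H: "subgroup H tree_aut_group"
    and \<nu>': "\<nu>' ` S' \<subseteq> K" and \<nu>: "\<nu> ` S \<subseteq> H"
    and place_in: "\<And>g. g \<in> K \<Longrightarrow> place V g \<in> K"
    and \<sigma>_value: "\<And>a. a \<in> letters S' \<Longrightarrow>
      word_value (aut_subgroup K) \<nu>' (\<sigma> a) = place V (letter_value (aut_subgroup K) \<nu>' a)"
    and \<rho>_value: "\<And>a. a \<in> letters S' \<Longrightarrow>
      word_value (aut_subgroup H) \<nu> (\<rho> a) = letter_value (aut_subgroup K) \<nu>' a"
    and moves: "\<nu>' \<kappa>0 V \<noteq> V" "\<nu>' \<kappa>1 V \<noteq> V" "\<nu>' \<kappa>0 V \<noteq> \<nu>' \<kappa>1 V"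
    and comm_neq_id: "comm (\<nu>' \<kappa>0) (\<nu>' \<kappa>1) \<noteq> id"
    and a0_value: "letter_value (aut_subgroup H) \<nu> a0 \<noteq> id"
begin

section \<open>Values of leaves and nodes\<close>

abbreviation "k \<equiv> \<nu>' \<kappa>0"
abbreviation "l \<equiv> \<nu>' \<kappa>1"
abbreviation "valH \<equiv> word_value (aut_subgroup H) \<nu>"
abbreviation "valK \<equiv> word_value (aut_subgroup K) \<nu>'"
abbreviation "letK \<equiv> letter_value (aut_subgroup K) \<nu>'"

lemma kl_in: "k \<in> K" "l \<in> K"
  using \<nu>' \<kappa> by auto

lemma letK_in: "a \<in> letters S' \<Longrightarrow> letK a \<in> K"
  using group.letter_value_closed[OF group_aut_subgroup[OF K], of \<nu>' S'] \<nu>' by simp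

lemma letK_inv: "a \<in> letters S' \<Longrightarrow> letK (inv_letter a) = inv_fun (letK a)"
  using group.letter_value_inv_letter[OF group_aut_subgroup[OF K], of \<nu>' S'] \<nu>' letK_in
    inv_aut_subgroup[OF K] by simp

lemma pad_value: "a \<in> letters S' \<Longrightarrow> valK (pad q a) = letK a"
  using group.word_value_Units[OF group_aut_subgroup[OF K], of \<nu>' S'] \<nu>'
  by (simp add: pad_def word_value_def)

text \<open>This counts the uses of \<open>\<sigma>\<close> in \<open>expand\<close>. The root block
  is excluded, as it applies \<open>\<rho>\<close>.\<close>

fun shifts :: "bool \<Rightarrow> bool list \<Rightarrow> nat" where
  "shifts act [] = 0"
| "shifts act (b # u) =
    (if u \<noteq> [] \<and> act \<and> \<not> b then Suc (shifts True u) else shifts (act \<and> \<not> b) u)"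

lemma shifts_False [simp]: "shifts False u = 0"
  by (induction u) auto

abbreviation shift :: "nat \<Rightarrow> ('x list \<Rightarrow> 'x list) \<Rightarrow> 'x list \<Rightarrow> 'x list" where
  "shift n \<equiv> place V ^^ n"

lemma expand_value:
  "u \<noteq> [] \<Longrightarrow> w \<in> lists (letters S') \<Longrightarrow> valH (expand act u w) = shift (shifts act u) (valK w)"
proof (induction act u w rule: expand.induct)
  case (2 act b u w)
  note w = \<open>w \<in> lists (letters S')\<close>
  note gK = group_aut_subgroup[OF K] and gH = group_aut_subgroup[OF H]
  have nK: "\<nu>' ` S' \<subseteq> carrier (aut_subgroup K)" and nH: "\<nu> ` S \<subseteq> carrier (aut_subgroup H)"
    using \<nu> \<nu>' by simp_all
  let ?w = "concat (map (block (act \<and> \<not> b) u) w)"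
  show ?case
  proof (cases "u = []")
    case True
    have "valH (concat (map \<rho> w)) = valK w"
      using word_value_substitution[OF gK nK gH nH w, where f = \<rho> and \<phi> = "\<lambda>x. x"] \<rho> \<rho>_value
      by simp
    then show ?thesis using True by (simp add: block_def)
  next
    case False
    let ?\<phi> = "if act \<and> \<not> b then place V else (\<lambda>x. x)"
    have "valK ?w = ?\<phi> (valK w)"
    proof (rule word_value_substitution[OF gK nK gK nK w])
      fix a assume a: "a \<in> letters S'"
      then show "block (act \<and> \<not> b) u a \<in> lists (letters S') \<and>
          valK (block (act \<and> \<not> b) u a) = ?\<phi> (letK a)"
        using block_wf(2)[OF a, of "act \<and> \<not> b" u] False \<sigma>_value[OF a] pad_value[OF a]
        by (auto simp: block_def)
    next
      fix x y
      have "?\<phi> (y \<circ> x) = ?\<phi> y \<circ> ?\<phi> x"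
        by (simp only: place_comp split: if_split) simp
      then show "?\<phi> (x \<otimes>\<^bsub>aut_subgroup K\<^esub> y) = ?\<phi> x \<otimes>\<^bsub>aut_subgroup K\<^esub> ?\<phi> y"
        by (simp only: partial_object.update_convs monoid.simps tree_aut_group_def)
    next
      have "?\<phi> id = id"
        by (simp only: place_id split: if_split) simp
      then show "?\<phi> \<one>\<^bsub>aut_subgroup K\<^esub> = \<one>\<^bsub>aut_subgroup K\<^esub>"
        by (simp only: partial_object.update_convs monoid.simps tree_aut_group_def)
    qed
    moreover have "?w \<in> lists (letters S')"
      using concat_block_wf(2)[OF w, of "act \<and> \<not> b" u] False by simp
    ultimately show ?thesis
      using "2.IH"[OF False] False by (auto simp: funpow_swap1)
  qed
qed simp

text \<open>
  The exponent is the number of zeros at the end of \<open>p\<close>, plus one if \<open>p\<close> contains a one.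
\<close>

definition node :: "bool list \<Rightarrow> ('x list \<Rightarrow> 'x list) \<times> ('x list \<Rightarrow> 'x list)" where
  "node p = (shift (shifts True (False # rev p)) (letK (fst (pair_at p))), letK (snd (pair_at p)))"

lemma shift_in: "g \<in> K \<Longrightarrow> shift n g \<in> K"
  by (induction n) (auto intro: place_in)

lemma shift_inv: "g \<in> K \<Longrightarrow> inv_fun (shift n g) = shift n (inv_fun g)"
  by (induction n) (auto simp: place_inv tree_aut_bij subgroup_tree_aut[OF K] shift_in)

lemma bij_shift: "bij g \<Longrightarrow> bij (shift n g)"
  by (induction n) (auto intro: place_bij)

lemma shift_comm: "bij g \<Longrightarrow> bij h \<Longrightarrow> shift n (comm g h) = comm (shift n g) (shift n h)"
  by (induction n) (auto simp: place_comm bij_shift)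

lemma shift_eq_id: "shift n g = id \<longleftrightarrow> g = id"
proof (induction n)
  case (Suc n)
  have "shift (Suc n) g = place V (shift n g)" by simp
  then show ?case using Suc place_eq_id by metis
qed simp

lemma pair_at_letters: "fst (pair_at p) \<in> letters S'" "snd (pair_at p) \<in> letters S'"
  using pair_at_in[of p] by auto

lemma node_in: "fst (node p) \<in> K" "snd (node p) \<in> K"
  by (auto simp: node_def pair_at_letters intro!: letK_in shift_in simp del: shifts.simps)

lemma node_Nil: "node [] = (k, l)"
  by (simp add: node_def pair_at_def)

lemma pair_at_snoc: "pair_at (p @ [b]) = next_pair (pair_at p) b"
  by (simp add: pair_at_def)

lemma node_False: "node (p @ [False]) = (place V (inv_fun (fst (node p))), k)"
proof -
  have "shifts True (False # rev (p @ [False])) = Suc (shifts True (False # rev p))" by simp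
  then show ?thesis
    by (cases "pair_at p")
       (use pair_at_letters[of p] in \<open>auto simp: node_def pair_at_snoc shift_inv letK_in letK_inv simp del: shifts.simps\<close>)
qed

text \<open>The second entry of a node is never placed, so after a bit 1 the first entry is placed
  exactly once.\<close>

lemma node_True: "node (p @ [True]) = (place V (inv_fun (snd (node p))), l)"
proof -
  have "shifts True (False # rev (p @ [True])) = 1" by simp
  then show ?thesis
    by (cases "pair_at p")
       (use pair_at_letters[of p] in \<open>auto simp: node_def pair_at_snoc letK_inv simp del: shifts.simps\<close>)
qed

text \<open>A final bit 0 leaves as many substitutions by \<open>\<sigma>\<close> as
  \<open>node p\<close> has placements; a final bit 1 suppresses all of them.\<close>

lemma leaf_value:
  "valH (leaf (p @ [False])) = fst (node p)" "valH (leaf (p @ [True])) = snd (node p)"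
proof -
  have single: "valK [a] = letK a" for a by (simp add: word_value_def)
  have "valH (leaf (p @ [b])) = shift (shifts True (rev (p @ [b]))) (letK (base (p @ [b])))" for b
    using expand_value[of "rev (p @ [b])" "[base (p @ [b])]" True] base_in[of "p @ [b]"]
    by (simp add: leaf_def single)
  note this[of False] this[of True]
  then show "valH (leaf (p @ [False])) = fst (node p)" "valH (leaf (p @ [True])) = snd (node p)"
    by (cases "pair_at p"; simp add: base_def pair_at_snoc node_def)+
qed

text \<open>The order of composition in \<open>comm\<close> reflects the right action, in which the
  product of \<open>g\<close> and \<open>h\<close> is \<open>h \<circ> g\<close>.\<close>

lemma valH_commutator_word:
  assumes "u \<in> lists (letters S)" "w \<in> lists (letters S)"
  shows "valH (commutator_word u w) = comm (valH u) (valH w)"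
proof -
  note gH = group_aut_subgroup[OF H]
  have nH: "\<nu> ` S \<subseteq> carrier (aut_subgroup H)" using \<nu> by simp
  have "valH u \<in> H" "valH w \<in> H"
    using group.word_value_closed[OF gH nH] assms by auto
  then show ?thesis
    unfolding group.word_value_commutator_word[OF gH nH assms]
    by (simp add: inv_aut_subgroup[OF H] comm_def comp_assoc)
qed

text \<open>Parents of leaves carry no extra placement, and every level above them adds one by
  \<open>comm_comm_place\<close>.\<close>

lemma words_value:
  "length p < d \<Longrightarrow> valH (words d p) = shift (d - Suc (length p)) (comm (fst (node p)) (snd (node p)))"
proof (induction "d - Suc (length p)" arbitrary: p)
  case 0
  then have "d = Suc (length p)" by simp
  then show ?case
    using words_node[of p d] leaf_wf(1)
    by (simp add: valH_commutator_word words_leaf leaf_value)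
next
  case (Suc n)
  have IH: "valH (words d (p @ [b])) = shift n (comm (fst (node (p @ [b]))) (snd (node (p @ [b]))))" for b
  proof -
    have n: "n = d - Suc (length (p @ [b]))" "length (p @ [b]) < d" using Suc.hyps(2) by auto
    show ?thesis using Suc.hyps(1)[OF n] unfolding n(1)[symmetric] .
  qed
  let ?g = "fst (node p)" and ?h = "snd (node p)"
  let ?a = "place V (inv_fun ?g)" and ?b = "place V (inv_fun ?h)"
  have aut: "tree_aut g" if "g \<in> K" for g using subgroup_tree_aut[OF K that] .
  have in_K: "?a \<in> K" "?b \<in> K" using node_in[of p] by (auto intro: place_in inv_fun_in[OF K])
  have bij: "bij ?a" "bij ?b" "bij k" "bij l"
    using in_K kl_in by (auto intro: tree_aut_bij aut)
  have "valH (words d p) = comm (valH (words d (p @ [False]))) (valH (words d (p @ [True])))"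
    using words_node[OF Suc.prems] words_wf by (simp add: valH_commutator_word)
  also have "\<dots> = comm (shift n (comm ?a k)) (shift n (comm ?b l))"
    by (simp add: IH node_False node_True)
  also have "\<dots> = shift n (comm (comm ?a k) (comm ?b l))"
    using bij by (simp add: shift_comm bij_comm)
  also have "comm (comm ?a k) (comm ?b l) = place V (comm ?g ?h)"
    using node_in[of p] kl_in moves by (intro comm_comm_place aut) auto
  also have "shift n (place V (comm ?g ?h)) = shift (d - Suc (length p)) (comm ?g ?h)"
    unfolding Suc.hyps(2)[symmetric] by (simp add: funpow_swap1)
  finally show ?case .
qed

lemma SENS_words_words: "SENS_words (aut_subgroup H) S \<nu> q words"
  unfolding SENS_words_def
proof (intro allI conjI impI)
  fix d
  show "valH (words d []) \<noteq> \<one>\<^bsub>aut_subgroup H\<^esub>"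
  proof (cases d)
    case 0
    then show ?thesis using a0_value by (simp add: words_leaf leaf_def word_value_def)
  next
    case (Suc n)
    then show ?thesis using words_value[of "[]" d] comm_neq_id by (simp add: node_Nil shift_eq_id)
  qed
qed (use words_wf words_node in \<open>auto simp: words_leaf leaf_wf\<close>)

end

text \<open>Stated for an overgroup \<open>H\<close> in order to cover \<open>K\<close> and
  \<open>G\<close> at once: the tree lives in \<open>K\<close>, and only the last substitution
  refers to the generators of \<open>H\<close>.\<close>

lemma uniformly_SENS_overgroup:
  fixes K H :: "('x list \<Rightarrow> 'x list) set"
  assumes K: "subgroup K tree_aut_group" and nontriv: "K \<noteq> {id}"
    and place_at: "\<And>g x. g \<in> K \<Longrightarrow> place_at x g \<in> K"
    and fgK: "finitely_generated (aut_subgroup K)"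
    and H: "subgroup H tree_aut_group" and KH: "K \<subseteq> H"
    and fgH: "finitely_generated (aut_subgroup H)"
  shows "uniformly_SENS (aut_subgroup H)"
  unfolding uniformly_SENS_def
proof (intro conjI allI impI fgH)
  fix S \<nu> assume "standard_gens (aut_subgroup H) S \<nu>"
  then have S: "finite S" "\<nu> ` S \<subseteq> H" "generate (aut_subgroup H) (\<nu> ` S) = H"
    by (auto simp: standard_gens_def)
  interpret gK: group "aut_subgroup K" by (rule group_aut_subgroup[OF K])
  interpret gH: group "aut_subgroup H" by (rule group_aut_subgroup[OF H])
  have place: "place v g \<in> K" if "g \<in> K" for v g
    using that place_at by (induction v) (auto simp: place_def)
  have "id \<in> K" using gK.one_closed by simp
  then obtain k where k: "k \<in> K" "k \<noteq> id" using nontriv by blast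
  then obtain u where u: "k u \<noteq> u" by (auto simp: fun_eq_iff)
  define l where "l = place u k"
  \<comment> \<open>\<open>k\<close> changes the first half of \<open>V\<close> and \<open>l\<close>
    only the second, so \<open>V\<close> and its two images are distinct.\<close>
  define V where "V = u @ u"
  have l: "l \<in> K" using place k by (simp add: l_def)
  have aut: "tree_aut k" using subgroup_tree_aut[OF K] k by simp
  have "take (length u) (k V) = k u" by (simp add: tree_aut_take[OF aut] V_def)
  moreover have "l V = u @ k u" by (simp add: l_def V_def)
  ultimately have moves: "k V \<noteq> V" "l V \<noteq> V" "k V \<noteq> l V"
    using u by (auto simp: V_def)

  obtain X where X: "finite X" "X \<subseteq> K" "generate (aut_subgroup K) X = K"
    using fgK by (auto simp: finitely_generated_def)
  obtain xs where xs: "set xs = X" using finite_list[OF X(1)] by blast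
  \<comment> \<open>Adding \<open>k\<close> and \<open>l\<close> to the generators of
    \<open>K\<close> makes them single letters, with indices 0 and 1.\<close>
  define \<nu>' where "\<nu>' = nth (k # l # xs)"
  define S' where "S' = {..<length (k # l # xs)}"
  have \<nu>'_S': "\<nu>' ` S' = insert k (insert l X)"
  proof -
    have "\<nu>' ` S' = set (k # l # xs)" by (auto simp: \<nu>'_def S'_def set_conv_nth image_iff)
    then show ?thesis using xs by simp
  qed
  have \<nu>': "\<nu>' ` S' \<subseteq> K" using \<nu>'_S' k l X(2) by simp
  have "generate (aut_subgroup K) X \<subseteq> generate (aut_subgroup K) (\<nu>' ` S')"
    by (rule gK.mono_generate) (simp add: \<nu>'_S' subset_insertI2)
  then have gen': "generate (aut_subgroup K) (\<nu>' ` S') = K"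
    using gK.generate_incl[of "\<nu>' ` S'"] \<nu>' X(3) by auto
  have fin': "finite (letters S')" by (simp add: S'_def)
  let ?let = "letter_value (aut_subgroup K) \<nu>'"
  have let_in: "?let ` letters S' \<subseteq> K"
    using gK.letter_value_closed[of \<nu>' S'] \<nu>' by auto

  \<comment> \<open>Otherwise all words would be trivial, but \<open>H\<close> contains
    \<open>k\<close>.\<close>
  have "\<exists>a0 \<in> letters S. letter_value (aut_subgroup H) \<nu> a0 \<noteq> id"
  proof (rule ccontr)
    assume "\<not> ?thesis"
    then have triv: "letter_value (aut_subgroup H) \<nu> a = id" if "a \<in> letters S" for a
      using that by blast
    have "word_value (aut_subgroup H) \<nu> w = id" if "w \<in> lists (letters S)" for w
      using that by (induction w) (auto simp: word_value_def triv)
    moreover have "k \<in> generate (aut_subgroup H) (\<nu> ` S)" using k KH S(3) by auto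
    ultimately show False using gH.generate_word[of \<nu> S k] S(2) k(2) by auto
  qed
  then obtain a0 where a0: "a0 \<in> letters S" "letter_value (aut_subgroup H) \<nu> a0 \<noteq> id" by blast

  obtain N1 where N1: "\<And>q. N1 \<le> q \<Longrightarrow> \<exists>\<sigma>. \<forall>a\<in>letters S'. \<sigma> a \<in> lists (letters S') \<and>
      length (\<sigma> a) = 2 ^ q \<and> word_value (aut_subgroup K) \<nu>' (\<sigma> a) = place V (?let a)"
    using gK.substitution_exists[of \<nu>' S' "letters S'" "\<lambda>a. place V (?let a)"]
      \<nu>' gen' fin' let_in place by (auto simp: image_subset_iff)
  obtain N2 where N2: "\<And>q. N2 \<le> q \<Longrightarrow> \<exists>\<sigma>. \<forall>a\<in>letters S'. \<sigma> a \<in> lists (letters S) \<and>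
      length (\<sigma> a) = 2 ^ q \<and> word_value (aut_subgroup H) \<nu> (\<sigma> a) = ?let a"
    using gH.substitution_exists[of \<nu> S "letters S'" ?let] S fin' subset_trans[OF let_in KH] by auto
  \<comment> \<open>The successor makes blocks of positions non-empty.\<close>
  define q where "q = Suc (max N1 N2)"
  have "N1 \<le> q" "N2 \<le> q" by (auto simp: q_def)
  then obtain \<sigma> \<rho> where
    \<sigma>: "\<And>a. a \<in> letters S' \<Longrightarrow> \<sigma> a \<in> lists (letters S') \<and>
      length (\<sigma> a) = 2 ^ q \<and> word_value (aut_subgroup K) \<nu>' (\<sigma> a) = place V (?let a)" and
    \<rho>: "\<And>a. a \<in> letters S' \<Longrightarrow> \<rho> a \<in> lists (letters S) \<and>
      length (\<rho> a) = 2 ^ q \<and> word_value (aut_subgroup H) \<nu> (\<rho> a) = ?let a"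
    using N1[of q] N2[of q] by metis
  have \<nu>'_kl: "\<nu>' 0 = k" "\<nu>' (Suc 0) = l" by (simp_all add: \<nu>'_def)
  interpret branching_words q S' S \<sigma> \<rho> 0 "Suc 0" a0 K H \<nu>' \<nu> V
  proof (intro branching_words.intro leaf_words.intro branching_words_axioms.intro)
    show "comm (\<nu>' 0) (\<nu>' (Suc 0)) \<noteq> id"
      unfolding \<nu>'_kl l_def by (rule comm_place_neq_id[OF aut u])
  qed (use \<sigma> \<rho> S \<nu>' K H a0 place moves in \<open>auto simp: q_def S'_def \<nu>'_kl\<close>)
  show "\<exists>\<mu> g. SENS_words (aut_subgroup H) S \<nu> \<mu> g \<and> letter_language S \<mu> g \<in> DLINTIME (insyms S)"
    using SENS_words_words letter_language_words by blast
qed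

theorem theorem31:
  fixes G K :: "('x::finite list \<Rightarrow> 'x list) set"
  assumes "self_similar G"
    and "weakly_branched G"
    and "finitely_generated (tree_aut_group\<lparr>carrier := G\<rparr>)"
    and "branching_subgroup K G"
    and "finitely_generated (tree_aut_group\<lparr>carrier := K\<rparr>)"
  shows "uniformly_SENS (tree_aut_group\<lparr>carrier := K\<rparr>) \<and>
         uniformly_SENS (tree_aut_group\<lparr>carrier := G\<rparr>)"
proof -
  have G: "subgroup G tree_aut_group" using assms(1) by (simp add: self_similar_def)
  have KG: "subgroup K (aut_subgroup G)" using assms(4) by (simp add: branching_subgroup_def)
  have K: "subgroup K tree_aut_group"
    by (rule group.incl_subgroup[OF group_tree_aut_group G KG])
  have "K \<subseteq> G" using subgroup.subset[OF KG] by simp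
  moreover have "K \<noteq> {id}" "\<And>g x. g \<in> K \<Longrightarrow> place_at x g \<in> K"
    using assms(4) by (auto simp: branching_subgroup_def tree_aut_group_def)
  ultimately show ?thesis
    using uniformly_SENS_overgroup[OF K _ _ assms(5)] K G assms(3,5) by blast
qed

end
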